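(* Let $0<a<1$ and $0\le b<1$, and suppose that $f_\pm$ has an irrational rotation number $\rho=\rho(f_\pm)$. Let $\Lambda_0:=\phi_\rho([0,1))$, let $\overline{\Lambda_0}$ be its closure, and let $\eta_i:=\phi_\rho(\{i\rho\})$ for $i\ge1$. Then $$\Lambda_\pm=\overline{\Lambda_0}=\{\phi_\rho(x),\phi_\rho(x-):x\in[0,1]\},$$ $$\Lambda_-=\Lambda_0=\{\phi_\rho(x):x\in[0,1)\},$$ $$\Lambda_+=\Lambda_1:=\{\phi_\rho(x-):x\in(0,1]\}=\overline{\Lambda_0}\setminus\{0,\eta_1,\eta_2,\dots\}.$$ Furthermore, the limit sets satisfy $\omega_{f_\pm}(x)=\omega_{f_-}(x)=\omega_{f_+}(x)=\Lambda_\pm$ for every $x\in[0,1]$. For any orbit $(x_n)_{n\ge0}$ of $f_\pm$, the distance satisfies $d(x_n,\Lambda_\pm)\le a^n$ for every $n\ge0$; hence the orbits converge to $\Lambda_\pm$ uniformly (and geometrically).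
   Context: For real $x$ let $\{x\}:=x-\lfloor x\rfloor\in[0,1)$ and $\{x\}_+:=1-\{-x\}\in(0,1]$. For constants $0<a<1$, $0\le b<1$ define $f_-,f_+:[0,1]\to[0,1]$ by $f_-(x)=\{ax+b\}$, $f_+(x)=\{ax+b\}_+$, and let $f_\pm$ be the multi-valued map $x\mapsto\{f_-(x),f_+(x)\}$. For $K\subseteq[0,1]$, $f_\pm(K):=f_-(K)\cup f_+(K)$. An orbit of $x\in[0,1]$ under $f_\pm$ is any sequence $(x_n)_{n\ge0}$ with $x_0=x$ and $x_{n+1}\in f_\pm(x_n)$ for all $n\ge0$ (for $f_-$ or $f_+$ alone, orbits are the usual ones). Invariant sets: $\Lambda_\pm:=\bigcap_{n\ge0}f_\pm^n([0,1])$, $\Lambda_-:=\bigcap_{n\ge0}f_-^n([0,1])$, $\Lambda_+:=\bigcap_{n\ge0}f_+^n([0,1])$. Limit sets: for $g\in\{f_-,f_+,f_\pm\}$, $\omega_g(x)$ is the set of all $p\in[0,1]$ such that some orbit of $x$ under $g$ has a subsequence converging to $p$. Rotation number: let $F_-(x):=ax+b+(1-a)\lfloor x\rfloor$ and $F_+(x):=ax+b-(1-a)\lfloor 1-x\rfloor$ for $x\in\mathbb R$. The rotation number $\rho(f_\pm)\in[0,1)$ is the number such that $F_-^n(x)/n\to\rho(f_\pm)$ and $F_+^n(x)/n\to\rho(f_\pm)$ as $n\to\infty$ for every $x\in\mathbb R$ (the limits exist, coincide and do not depend on $x$). For $x\in\mathbb R$, $$\phi_\rho(x):=\frac{b}{1-a}+(1-a)\sum_{j=0}^\infty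 a^j\lfloor x-(j+1)\rho\rfloor,$$ and $\phi_\rho(x-)$ denotes its left limit at $x$. $d(\cdot,\cdot)$ is Euclidean distance. *)

theory Defs
  imports "HOL-Analysis.Analysis"
begin

definition frac_plus :: "real \<Rightarrow> real" where
  "frac_plus x = 1 - frac (- x)"

text \<open>The maps are only ever applied to points of \<open>[0,1]\<close>, which they preserve.\<close>

definition f_minus :: "real \<Rightarrow> real \<Rightarrow> real \<Rightarrow> real" where
  "f_minus a b x = frac (a * x + b)"

definition f_plus :: "real \<Rightarrow> real \<Rightarrow> real \<Rightarrow> real" where
  "f_plus a b x = frac_plus (a * x + b)"

definition f_pm :: "real \<Rightarrow> real \<Rightarrow> real \<Rightarrow> real set" where
  "f_pm a b x = {f_minus a b x, f_plus a b x}"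

definition f_pm_image :: "real \<Rightarrow> real \<Rightarrow> real set \<Rightarrow> real set" where
  "f_pm_image a b K = f_minus a b ` K \<union> f_plus a b ` K"

definition Lambda_pm :: "real \<Rightarrow> real \<Rightarrow> real set" where
  "Lambda_pm a b = (\<Inter>n. (f_pm_image a b ^^ n) {0..1})"

definition Lambda_minus :: "real \<Rightarrow> real \<Rightarrow> real set" where
  "Lambda_minus a b = (\<Inter>n. (f_minus a b ^^ n) ` {0..1})"

definition Lambda_plus :: "real \<Rightarrow> real \<Rightarrow> real set" where
  "Lambda_plus a b = (\<Inter>n. (f_plus a b ^^ n) ` {0..1})"

text \<open>Orbits are defined for set-valued maps \<open>G\<close>; an ordinary map \<open>g\<close> is regarded as
  the set-valued map \<open>\<lambda>x. {g x}\<close>.\<close>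

definition is_orbit :: "(real \<Rightarrow> real set) \<Rightarrow> real \<Rightarrow> (nat \<Rightarrow> real) \<Rightarrow> bool" where
  "is_orbit G x xs \<longleftrightarrow> xs 0 = x \<and> (\<forall>n. xs (Suc n) \<in> G (xs n))"

definition omega_limit :: "(real \<Rightarrow> real set) \<Rightarrow> real \<Rightarrow> real set" where
  "omega_limit G x =
     {p \<in> {0..1}. \<exists>xs r. is_orbit G x xs \<and> strict_mono r \<and> (xs \<circ> r) \<longlonglongrightarrow> p}"

definition F_minus :: "real \<Rightarrow> real \<Rightarrow> real \<Rightarrow> real" where
  "F_minus a b x = a * x + b + (1 - a) * of_int \<lfloor>x\<rfloor>"

definition F_plus :: "real \<Rightarrow> real \<Rightarrow> real \<Rightarrow> real" where
  "F_plus a b x = a * x + b - (1 - a) * of_int \<lfloor>1 - x\<rfloor>"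

definition is_rotation_number :: "real \<Rightarrow> real \<Rightarrow> real \<Rightarrow> bool" where
  "is_rotation_number a b \<rho> \<longleftrightarrow> \<rho> \<in> {0..<1} \<and>
     (\<forall>x. (\<lambda>n. (F_minus a b ^^ n) x / real n) \<longlonglongrightarrow> \<rho>) \<and>
     (\<forall>x. (\<lambda>n. (F_plus a b ^^ n) x / real n) \<longlonglongrightarrow> \<rho>)"

definition rotation_number :: "real \<Rightarrow> real \<Rightarrow> real" where
  "rotation_number a b = (THE \<rho>. is_rotation_number a b \<rho>)"

definition phi :: "real \<Rightarrow> real \<Rightarrow> real \<Rightarrow> real \<Rightarrow> real" where
  "phi a b \<rho> x =
     b / (1 - a) + (1 - a) * (\<Sum>j. a ^ j * of_int \<lfloor>x - real (j + 1) * \<rho>\<rfloor>)"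

definition phi_left :: "real \<Rightarrow> real \<Rightarrow> real \<Rightarrow> real \<Rightarrow> real" where
  "phi_left a b \<rho> x = Lim (at_left x) (phi a b \<rho>)"

text \<open>The description defining \<^const>\<open>rotation_number\<close>, the series in \<^const>\<open>phi\<close>
  and the limit in \<^const>\<open>phi_left\<close> are all well-defined.\<close>

locale degree_one =
  fixes F :: "real \<Rightarrow> real"
  assumes mono: "mono F" and add1: "\<And>x. F (x + 1) = F x + 1"
begin

lemma iter_mono: "x \<le> y \<Longrightarrow> (F ^^ n) x \<le> (F ^^ n) y"
  by (induction n) (auto intro: monoD[OF mono])

lemma iter_add1: "(F ^^ n) (x + 1) = (F ^^ n) x + 1"
  by (induction n) (auto simp: add1)

lemma iter_add_nat: "(F ^^ n) (x + real k) = (F ^^ n) x + real k"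
proof (induction k)
  case (Suc k)
  have "(F ^^ n) (x + real (Suc k)) = (F ^^ n) ((x + real k) + 1)"
    by (simp add: algebra_simps)
  also have "\<dots> = (F ^^ n) (x + real k) + 1"
    by (rule iter_add1)
  finally show ?case
    using Suc by simp
qed simp

lemma iter_add_int: "(F ^^ n) (x + of_int k) = (F ^^ n) x + of_int k"
proof (cases "k \<ge> 0")
  case True
  then show ?thesis
    using iter_add_nat[of n x "nat k"] by simp
next
  case False
  then show ?thesis
    using iter_add_nat[of n "x + of_int k" "nat (- k)"] by simp
qed

lemma iter_displacement: "\<bar>((F ^^ n) x - x) - (F ^^ n) 0\<bar> \<le> 1"
proof -
  have "(F ^^ n) (0 + of_int \<lfloor>x\<rfloor>) \<le> (F ^^ n) x"
    by (rule iter_mono) simp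
  moreover have "(F ^^ n) x \<le> (F ^^ n) (0 + of_int \<lfloor>x\<rfloor> + 1)"
    by (rule iter_mono) linarith
  ultimately show ?thesis
    unfolding iter_add1 iter_add_int by linarith
qed

lemma iter_mult: "\<bar>(F ^^ (m * n)) 0 - real m * (F ^^ n) 0\<bar> \<le> real m"
proof (induction m)
  case (Suc m)
  have "(F ^^ (Suc m * n)) 0 = (F ^^ n) ((F ^^ (m * n)) 0)"
    by (simp add: funpow_add)
  then show ?case
    using Suc iter_displacement[of n "(F ^^ (m * n)) 0"]
    by (simp add: algebra_simps abs_le_iff)
qed simp

lemma iter_quotient_close:
  assumes "m > 0" "n > 0"
  shows "\<bar>(F ^^ m) 0 / real m - (F ^^ n) 0 / real n\<bar> \<le> 1 / real m + 1 / real n"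
proof -
  have *: "\<bar>(F ^^ (k * l)) 0 / (real k * real l) - (F ^^ l) 0 / real l\<bar> \<le> 1 / real l"
    if "k > 0" "l > 0" for k l
  proof -
    have "(F ^^ (k * l)) 0 / (real k * real l) - (F ^^ l) 0 / real l
        = ((F ^^ (k * l)) 0 - real k * (F ^^ l) 0) / (real k * real l)"
      using that by (simp add: field_simps)
    also have "\<bar>\<dots>\<bar> \<le> real k / (real k * real l)"
      using divide_right_mono[OF iter_mult[of k l], of "real k * real l"]
      by (simp only: abs_divide) simp
    finally show ?thesis
      using that by simp
  qed
  show ?thesis
    using *[OF assms] *[OF assms(2,1)] by (simp add: mult.commute abs_le_iff)
qed

lemma translation_number_exists: "\<exists>\<rho>. \<forall>x. (\<lambda>n. (F ^^ n) x / real n) \<longlonglongrightarrow> \<rho>"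
proof -
  have "Cauchy (\<lambda>n. (F ^^ n) 0 / real n)"
  proof (rule metric_CauchyI)
    fix e :: real assume "e > 0"
    then obtain N where N: "N > 0" "1 / real N < e / 2"
      using real_arch_inverse[of "e / 2"] by (auto simp: inverse_eq_divide)
    have "dist ((F ^^ m) 0 / real m) ((F ^^ n) 0 / real n) < e" if "m \<ge> N" "n \<ge> N" for m n
    proof -
      have "1 / real m \<le> 1 / real N" "1 / real n \<le> 1 / real N"
        using that N by (simp_all add: frac_le)
      then show ?thesis
        using iter_quotient_close[of m n] that N by (simp add: dist_real_def)
    qed
    then show "\<exists>M. \<forall>m\<ge>M. \<forall>n\<ge>M. dist ((F ^^ m) 0 / real m) ((F ^^ n) 0 / real n) < e"
      by blast
  qed
  then obtain \<rho> where \<rho>: "(\<lambda>n. (F ^^ n) 0 / real n) \<longlonglongrightarrow> \<rho>"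
    using Cauchy_convergent convergent_def by blast
  have "(\<lambda>n. (F ^^ n) x / real n) \<longlonglongrightarrow> \<rho>" for x
  proof -
    have "(\<lambda>n. ((F ^^ n) x - (F ^^ n) 0) / real n) \<longlonglongrightarrow> 0"
    proof (rule Lim_null_comparison)
      show "\<forall>\<^sub>F n in sequentially.
          norm (((F ^^ n) x - (F ^^ n) 0) / real n) \<le> (1 + \<bar>x\<bar>) / real n"
      proof (rule always_eventually, rule allI)
        fix n
        have "\<bar>(F ^^ n) x - (F ^^ n) 0\<bar> \<le> 1 + \<bar>x\<bar>"
          using iter_displacement[of n x] by linarith
        then show "norm (((F ^^ n) x - (F ^^ n) 0) / real n) \<le> (1 + \<bar>x\<bar>) / real n"
          by (simp add: divide_right_mono)
      qed
      show "(\<lambda>n. (1 + \<bar>x\<bar>) / real n) \<longlonglongrightarrow> 0"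
        by (rule lim_const_over_n)
    qed
    from tendsto_add[OF this \<rho>] show ?thesis
      by (simp add: add_divide_distrib[symmetric])
  qed
  then show ?thesis by blast
qed

end

lemma degree_one_F_minus:
  assumes "0 < a" "a < 1"
  shows "degree_one (F_minus a b)"
proof
  show "mono (F_minus a b)"
    unfolding F_minus_def using assms
    by (intro monoI add_mono mult_left_mono) (auto intro: floor_mono)
qed (simp add: F_minus_def algebra_simps)

lemma degree_one_F_plus:
  assumes "0 < a" "a < 1"
  shows "degree_one (F_plus a b)"
proof
  show "mono (F_plus a b)"
    unfolding F_plus_def using assms
    by (intro monoI diff_mono add_mono mult_left_mono) (auto intro: floor_mono)
  fix x :: real
  have "1 - (x + 1) = (1 - x) - 1"
    by simp
  then have *: "\<lfloor>1 - (x + 1)\<rfloor> = \<lfloor>1 - x\<rfloor> - 1"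
    by (simp only: floor_diff_one)
  show "F_plus a b (x + 1) = F_plus a b x + 1"
    unfolding F_plus_def * by (simp only: of_int_diff of_int_1) (simp add: field_simps)
qed

lemma F_plus_le_F_minus:
  assumes "a < 1"
  shows "F_plus a b x \<le> F_minus a b x"
proof -
  have "- \<lfloor>1 - x\<rfloor> \<le> \<lfloor>x\<rfloor>"
    by linarith
  then have "(1 - a) * of_int (- \<lfloor>1 - x\<rfloor>) \<le> (1 - a) * of_int \<lfloor>x\<rfloor>"
    using assms by (intro mult_left_mono) (auto simp flip: of_int_minus)
  then show ?thesis
    by (simp add: F_plus_def F_minus_def)
qed

lemma F_minus_less_F_plus:
  assumes "0 < a" "a < 1" "x < y"
  shows "F_minus a b x < F_plus a b y"
proof -
  have "\<lfloor>x\<rfloor> \<le> - \<lfloor>1 - y\<rfloor>"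
    using assms by linarith
  then have "(1 - a) * of_int \<lfloor>x\<rfloor> \<le> (1 - a) * of_int (- \<lfloor>1 - y\<rfloor>)"
    using assms by (intro mult_left_mono) (auto simp flip: of_int_minus)
  moreover have "a * x < a * y"
    using assms by simp
  ultimately show ?thesis
    by (simp add: F_plus_def F_minus_def)
qed

lemma rotation_number_exists:
  assumes a: "0 < a" "a < 1" and b: "0 \<le> b" "b < 1"
  shows "\<exists>!\<rho>. is_rotation_number a b \<rho>"
proof -
  interpret minus: degree_one "F_minus a b" by (rule degree_one_F_minus[OF a])
  interpret plus: degree_one "F_plus a b" by (rule degree_one_F_plus[OF a])
  obtain \<rho> where \<rho>: "\<And>x. (\<lambda>n. (F_minus a b ^^ n) x / real n) \<longlonglongrightarrow> \<rho>"
    using minus.translation_number_exists by blast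
  obtain \<sigma> where \<sigma>: "\<And>x. (\<lambda>n. (F_plus a b ^^ n) x / real n) \<longlonglongrightarrow> \<sigma>"
    using plus.translation_number_exists by blast
  have le: "(F_plus a b ^^ n) 0 \<le> (F_minus a b ^^ n) 0" for n
  proof (induction n)
    case (Suc n)
    have "F_plus a b ((F_plus a b ^^ n) 0) \<le> F_plus a b ((F_minus a b ^^ n) 0)"
      using Suc by (rule monoD[OF plus.mono])
    also have "\<dots> \<le> F_minus a b ((F_minus a b ^^ n) 0)"
      using a by (intro F_plus_le_F_minus)
    finally show ?case by simp
  qed simp
  have less: "(F_minus a b ^^ n) 0 < (F_plus a b ^^ n) 1" for n
    by (induction n) (auto intro: F_minus_less_F_plus a)
  have "\<sigma> \<le> \<rho>"
    by (rule LIMSEQ_le[OF \<sigma>[of 0] \<rho>[of 0]]) (auto intro!: exI[of _ 0] divide_right_mono le)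
  moreover have "\<rho> \<le> \<sigma>"
    by (rule LIMSEQ_le[OF \<rho>[of 0] \<sigma>[of 1]])
      (auto intro!: exI[of _ 0] divide_right_mono less_imp_le[OF less])
  ultimately have eq: "\<sigma> = \<rho>" by simp
  have lower: "0 \<le> (F_minus a b ^^ n) 0" for n
  proof (induction n)
    case (Suc n)
    then show ?case using a b by (simp add: F_minus_def)
  qed simp
  have upper: "(F_minus a b ^^ n) 0 \<le> b * real n" for n
  proof (induction n)
    case (Suc n)
    let ?y = "(F_minus a b ^^ n) 0"
    have "(1 - a) * of_int \<lfloor>?y\<rfloor> \<le> (1 - a) * ?y"
      using a by (intro mult_left_mono) auto
    then have "F_minus a b ?y \<le> ?y + b"
      unfolding F_minus_def by (simp add: algebra_simps)
    then show ?case
      using Suc by (simp add: algebra_simps)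
  qed simp
  have "0 \<le> \<rho>"
    by (rule LIMSEQ_le_const[OF \<rho>[of 0]]) (auto intro!: exI[of _ 0] divide_nonneg_nonneg lower)
  moreover have "\<rho> \<le> b"
    by (rule LIMSEQ_le_const2[OF \<rho>[of 0]])
      (use upper in \<open>auto intro!: exI[of _ 1] simp: pos_divide_le_eq\<close>)
  ultimately have "is_rotation_number a b \<rho>"
    using \<rho> \<sigma> eq b by (auto simp: is_rotation_number_def)
  moreover have "\<tau> = \<rho>" if "is_rotation_number a b \<tau>" for \<tau>
    using that \<rho>[of 0] LIMSEQ_unique by (auto simp: is_rotation_number_def)
  ultimately show ?thesis by blast
qed

lemma is_rotation_number_rotation_number:
  assumes "0 < a" "a < 1" "0 \<le> b" "b < 1"
  shows "is_rotation_number a b (rotation_number a b)"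
  unfolding rotation_number_def by (rule theI'[OF rotation_number_exists[OF assms]])

lemma summable_phi:
  assumes a: "0 < a" "a < 1"
  shows "summable (\<lambda>j. a ^ j * of_int \<lfloor>x - real (j + 1) * \<rho>\<rfloor> :: real)"
proof (rule summable_comparison_test')
  have "summable (\<lambda>j. real (Suc j) * a ^ j)"
    using geometric_deriv_sums[of a] a by (simp add: sums_iff)
  moreover have "summable (\<lambda>j. a ^ j)"
    using a by (simp add: summable_geometric)
  ultimately show "summable (\<lambda>j. (\<bar>x\<bar> + 1) * a ^ j + \<bar>\<rho>\<bar> * (real (Suc j) * a ^ j))"
    by (intro summable_add summable_mult)
  fix j :: nat
  have "\<bar>of_int \<lfloor>x - real (j + 1) * \<rho>\<rfloor> :: real\<bar> \<le> \<bar>x - real (j + 1) * \<rho>\<bar> + 1"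
    by linarith
  also have "\<dots> \<le> \<bar>x\<bar> + \<bar>real (j + 1) * \<rho>\<bar> + 1"
    by linarith
  also have "\<dots> = \<bar>x\<bar> + 1 + \<bar>\<rho>\<bar> * real (Suc j)"
    by (simp add: abs_mult)
  finally have "a ^ j * \<bar>of_int \<lfloor>x - real (j + 1) * \<rho>\<rfloor>\<bar> \<le> a ^ j * (\<bar>x\<bar> + 1 + \<bar>\<rho>\<bar> * real (Suc j))"
    using a by (intro mult_left_mono) auto
  then show "norm (a ^ j * of_int \<lfloor>x - real (j + 1) * \<rho>\<rfloor>)
      \<le> (\<bar>x\<bar> + 1) * a ^ j + \<bar>\<rho>\<bar> * (real (Suc j) * a ^ j)"
    using a by (simp add: abs_mult algebra_simps)
qed

lemma mono_phi:
  assumes a: "0 < a" "a < 1"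
  shows "mono (phi a b \<rho>)"
  unfolding phi_def
  by (intro monoI add_left_mono mult_left_mono suminf_le summable_phi[OF a])
    (use a in \<open>auto intro!: mult_left_mono floor_mono\<close>)

lemma tendsto_phi_left:
  assumes a: "0 < a" "a < 1"
  shows "(phi a b \<rho> \<longlongrightarrow> phi_left a b \<rho> x) (at_left x)"
proof -
  have "(phi a b \<rho> \<longlongrightarrow> Sup (phi a b \<rho> ` ({..<x} \<inter> UNIV))) (at x within ({..<x} \<inter> UNIV))"
    by (rule Lim_left_bound[where K = "phi a b \<rho> x"]) (auto intro: monoD[OF mono_phi[OF a]])
  then have lim: "(phi a b \<rho> \<longlongrightarrow> Sup (phi a b \<rho> ` {..<x})) (at_left x)"
    by simp
  then show ?thesis
    unfolding phi_left_def by (subst tendsto_Lim[OF trivial_limit_at_left_real lim])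
qed

end

(*
  The function phi semiconjugates the lift F_minus to the translation by rho, provided
  phi(0) = 0. This normalisation holds because an irrational rotation number is strictly
  monotone in b, and it makes the closure of phi([0,1)) invariant. The only
  discontinuity of f lies in this closure, so f contracts the distance to it by the factor a;
  hence it is the attractor. The maps f_minus and f_plus are injective, the left
  limits of phi at its jumps are the f_minus-orbit of 1, which f_minus never hits, and the right
  values are the f_plus-orbit of 0, which f_plus never hits; this separates the attractors
  of f_minus and f_plus. Every orbit of F_minus is squeezed between two translates of phi along
  the dense rotation orbit, which yields the limit sets.
*)
theory Submission
  imports Defs
begin

text \<open>The series for \<open>phi\<close> comes from iterating \<open>phi x = a * phi (x -
  \<rho>) + b + (1 - a) * \<lfloor>x - \<rho>\<rfloor>\<close> backwards along the rotation;
  \<open>b / (1 - a)\<close> collects the constants \<open>b * a ^ j\<close>. This equation holds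
  for every \<open>\<rho>\<close>. Its right-hand side is \<open>F_minus\<close> at
  \<open>phi (x - \<rho>)\<close> only if \<open>phi\<close> preserves integer parts. Here, beyond
  the bounds on \<open>\<rho>\<close>, is where it matters that \<open>\<rho>\<close> belongs to
  this \<open>b\<close>: another offset moves \<open>phi\<close> by a constant, and the integers are
  then no longer fixed.

  The obstacle to a plain contraction argument is the discontinuity: points close to it on opposite
  sides are sent to opposite ends of [0,1]. Distances between arbitrary points therefore need not
  shrink, only the distance to an invariant set that contains the discontinuity.

  Taking left limits in the equation replaces floors by \<open>\<lceil>x\<rceil> - 1\<close>, which
  gives the lift \<open>F_plus\<close>. So \<open>phi_left\<close> does for \<open>f_plus\<close>
  what \<open>phi\<close> does for \<open>f_minus\<close>.\<close>

section \<open>Density of the multiples of an irrational number modulo 1\<close>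

lemma irrational_multiples_dense:
  fixes \<rho> u v :: real
  assumes "\<rho> \<notin> \<rat>" "u < v"
  obtains n :: nat and k :: int where "n \<ge> N" "n > 0" "u < real n * \<rho> - of_int k" "real n * \<rho> - of_int k < v"
proof -
  \<comment> \<open>Density is applied to the irrational number \<open>Suc N * \<rho>\<close>: any
    positive multiplier of it is a multiplier of \<open>\<rho>\<close> beyond
    \<open>N\<close>.\<close>
  let ?M = "Suc N"
  have "real ?M * \<rho> \<notin> \<rat>"
  proof
    assume "real ?M * \<rho> \<in> \<rat>"
    then have "(real ?M * \<rho>) / real ?M \<in> \<rat>" by (rule Rats_divide) simp
    then show False using assms by simp
  qed
  then obtain h m :: int where hm: "m > 0" "\<bar>of_int m * (real ?M * \<rho>) - of_int h - (u + v) / 2\<bar> < (v - u) / 2"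
    by (rule sequence_of_fractional_parts_is_dense[of "real ?M * \<rho>" "(v - u) / 2" "(u + v) / 2"]) (use assms in auto)
  have eq: "real (nat m * ?M) * \<rho> = of_int m * (real ?M * \<rho>)"
    using hm(1) by (simp add: algebra_simps)
  have "1 \<le> nat m" using hm(1) by simp
  from mult_le_mono1[OF this, of ?M] have M: "?M \<le> nat m * ?M" by (simp only: mult_1)
  have "nat m * ?M \<ge> N" "nat m * ?M > 0"
    by (rule Suc_leD[OF M], rule less_le_trans[OF zero_less_Suc M])
  moreover have "u < real (nat m * ?M) * \<rho> - of_int h" "real (nat m * ?M) * \<rho> - of_int h < v"
    unfolding eq using hm(2) by (simp_all add: abs_less_iff field_simps)
  ultimately show thesis by (rule that)
qed

section \<open>Functional equations, one-sided continuity and strict monotonicity of phi\<close>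

lemma phi_add_int:
  assumes a: "0 < a" "a < 1"
  shows "phi a b \<rho> (x + of_int k) = phi a b \<rho> x + of_int k"
proof -
  have "(\<lambda>j. a ^ j * of_int \<lfloor>x + of_int k - real (j + 1) * \<rho>\<rfloor>)
      = (\<lambda>j. a ^ j * of_int \<lfloor>x - real (j + 1) * \<rho>\<rfloor> + of_int k * a ^ j)"
  proof
    fix j
    have "\<lfloor>x + of_int k - real (j + 1) * \<rho>\<rfloor> = \<lfloor>x - real (j + 1) * \<rho>\<rfloor> + k"
      by linarith
    then show "a ^ j * of_int \<lfloor>x + of_int k - real (j + 1) * \<rho>\<rfloor>
      = a ^ j * of_int \<lfloor>x - real (j + 1) * \<rho>\<rfloor> + of_int k * a ^ j"
      by (simp add: algebra_simps)
  qed
  moreover have "(\<Sum>j. a ^ j * of_int \<lfloor>x - real (j + 1) * \<rho>\<rfloor> + of_int k * a ^ j)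
     = (\<Sum>j. a ^ j * of_int \<lfloor>x - real (j + 1) * \<rho>\<rfloor>) + of_int k * (1 / (1 - a))"
    using suminf_add[OF summable_phi[OF a, of x \<rho>] summable_mult[of "\<lambda>j. a ^ j" "of_int k"]]
      suminf_mult[of "\<lambda>j. a ^ j" "of_int k"] a
    by (simp add: summable_geometric suminf_geometric)
  ultimately show ?thesis
    unfolding phi_def using a by (simp add: algebra_simps add_divide_distrib diff_divide_distrib)
      (simp add: field_simps)
qed

text \<open>Adding \<open>\<rho>\<close> to the argument shifts the series by one index, with
  \<open>\<lfloor>x\<rfloor>\<close> as the new head term. The result is \<open>F_minus\<close> at
  \<open>phi x\<close>, except that it has \<open>\<lfloor>x\<rfloor>\<close> in place of the floor
  of \<open>phi x\<close>.\<close>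

lemma phi_add_rotation:
  assumes a: "0 < a" "a < 1"
  shows "phi a b \<rho> (x + \<rho>) = a * phi a b \<rho> x + b + (1 - a) * of_int \<lfloor>x\<rfloor>"
proof -
  let ?f = "\<lambda>j. a ^ j * of_int \<lfloor>x + \<rho> - real (j + 1) * \<rho>\<rfloor>"
  let ?g = "\<lambda>j. a ^ j * of_int \<lfloor>x - real (j + 1) * \<rho>\<rfloor>"
  have "x + \<rho> - real (Suc j + 1) * \<rho> = x - real (j + 1) * \<rho>" for j
    by (simp add: algebra_simps)
  then have "?f (Suc j) = a * ?g j" for j
    by (simp only: power_Suc mult.assoc)
  then have "(\<Sum>j. ?f (Suc j)) = a * (\<Sum>j. ?g j)"
    using suminf_mult[OF summable_phi[OF a, of x \<rho>], of a] by (simp only:)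
  moreover have "(\<Sum>j. ?f (Suc j)) = (\<Sum>j. ?f j) - ?f 0"
    by (rule suminf_split_head[OF summable_phi[OF a]])
  ultimately have "(\<Sum>j. ?f j) = of_int \<lfloor>x\<rfloor> + a * (\<Sum>j. ?g j)" by simp
  then have "phi a b \<rho> (x + \<rho>) = b / (1 - a) + (1 - a) * (of_int \<lfloor>x\<rfloor> + a * (\<Sum>j. ?g j))"
    unfolding phi_def by simp
  also have "\<dots> = a * phi a b \<rho> x + b + (1 - a) * of_int \<lfloor>x\<rfloor>"
  proof -
    have "b / (1 - a) = a * (b / (1 - a)) + b" using a by (simp add: field_simps)
    moreover have "\<beta> + (1 - a) * (s + a * t) = a * (\<beta> + (1 - a) * t) + b + (1 - a) * s"
      if "\<beta> = a * \<beta> + b" for \<beta> s t :: real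
      using that by (simp add: algebra_simps)
    ultimately show ?thesis unfolding phi_def by blast
  qed
  finally show ?thesis .
qed

text \<open>From index \<open>N\<close> on, floors at points at distance at most 1 differ by at most
  1, and the factor \<open>1 - a\<close> turns the geometric tail into exactly \<open>a ^ N\<close>.
  Both one-sided continuity lemmas reduce to this.\<close>

lemma phi_close:
  assumes a: "0 < a" "a < 1" and xy: "x \<le> y" "y \<le> x + 1"
    and eq: "\<And>j. j < N \<Longrightarrow> \<lfloor>y - real (j + 1) * \<rho>\<rfloor> = \<lfloor>x - real (j + 1) * \<rho>\<rfloor>"
  shows "phi a b \<rho> y - phi a b \<rho> x \<le> a ^ N"
proof -
  let ?f = "\<lambda>z j. a ^ j * of_int \<lfloor>z - real (j + 1) * \<rho>\<rfloor>"
  define g where "g = (\<lambda>j. if j < N then 0 else a ^ j)"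
  have summ_pow: "summable (\<lambda>j. a ^ j)" using a by (simp add: summable_geometric)
  have summ_g: "summable g"
    by (rule summable_comparison_test'[OF summ_pow]) (use a in \<open>auto simp: g_def\<close>)
  have "suminf g = (\<Sum>j. g (j + N)) + sum g {..<N}"
    by (rule suminf_split_initial_segment[OF summ_g])
  also have "sum g {..<N} = 0" by (simp add: g_def)
  also have "(\<lambda>j. g (j + N)) = (\<lambda>j. a ^ N * a ^ j)"
    by (simp add: g_def power_add mult.commute)
  finally have g: "suminf g = a ^ N / (1 - a)"
    using suminf_mult[OF summ_pow, of "a ^ N"] a by (simp add: suminf_geometric)
  have "(\<Sum>j. ?f y j - ?f x j) \<le> suminf g"
  proof (intro suminf_le summable_diff summable_phi a summ_g)
    fix j
    show "?f y j - ?f x j \<le> g j"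
    proof (cases "j < N")
      case True
      then show ?thesis using eq by (simp add: g_def)
    next
      case False
      have "\<lfloor>y - real (j + 1) * \<rho>\<rfloor> \<le> \<lfloor>x - real (j + 1) * \<rho>\<rfloor> + 1" using xy by linarith
      then have "(of_int \<lfloor>y - real (j + 1) * \<rho>\<rfloor> :: real) \<le> of_int \<lfloor>x - real (j + 1) * \<rho>\<rfloor> + 1" by linarith
      then have "a ^ j * of_int \<lfloor>y - real (j + 1) * \<rho>\<rfloor> \<le> a ^ j * (of_int \<lfloor>x - real (j + 1) * \<rho>\<rfloor> + 1)"
        using a by (intro mult_left_mono) auto
      then show ?thesis using False by (simp add: g_def algebra_simps)
    qed
  qed
  then have "(\<Sum>j. ?f y j) - (\<Sum>j. ?f x j) \<le> a ^ N / (1 - a)"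
    unfolding g suminf_diff[OF summable_phi[OF a] summable_phi[OF a]] .
  then have "(1 - a) * ((\<Sum>j. ?f y j) - (\<Sum>j. ?f x j)) \<le> (1 - a) * (a ^ N / (1 - a))"
    using a by (intro mult_left_mono) auto
  then show ?thesis
    unfolding phi_def using a by (simp add: right_diff_distrib)
qed

text \<open>The floor is right-continuous, so the first \<open>N\<close> floors do not change just
  to the right of \<open>x\<close>. A single witness \<open>y\<close> is a sufficient form of
  continuity because \<open>phi\<close> is monotone.\<close>

lemma phi_right_continuous:
  assumes a: "0 < a" "a < 1" and "e > 0"
  obtains y where "x < y" "phi a b \<rho> y < phi a b \<rho> x + e"
proof -
  obtain N where N: "a ^ N < e" using real_arch_pow_inv[of e a] assms by auto
  have "\<forall>\<^sub>F y in at_right x. \<forall>j\<in>{..<N}. \<lfloor>y - real (j + 1) * \<rho>\<rfloor> = \<lfloor>x - real (j + 1) * \<rho>\<rfloor>"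
  proof (intro eventually_ball_finite ballI)
    fix j
    let ?c = "real (j + 1) * \<rho>"
    have "x < of_int \<lfloor>x - ?c\<rfloor> + 1 + ?c" by linarith
    from eventually_at_right_less[of x] eventually_at_right_real[OF this]
    show "\<forall>\<^sub>F y in at_right x. \<lfloor>y - ?c\<rfloor> = \<lfloor>x - ?c\<rfloor>"
      by eventually_elim (simp, linarith)
  qed simp
  moreover have "\<forall>\<^sub>F y in at_right x. y \<in> {x<..<x + 1}"
    by (rule eventually_at_right_real) simp
  ultimately have "\<forall>\<^sub>F y in at_right x. x < y \<and> phi a b \<rho> y < phi a b \<rho> x + e"
  proof eventually_elim
    case (elim y)
    then show ?case using phi_close[OF a, of x y N \<rho> b] N by auto
  qed
  then show thesis using that eventually_happens'[OF trivial_limit_at_right_real] by blast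
qed

text \<open>The hypothesis says that no floor in the series jumps at \<open>x\<close>; hence
  finitely many of them are constant on a common interval ending at \<open>x\<close>.\<close>

lemma phi_left_continuous:
  assumes a: "0 < a" "a < 1" and "e > 0"
    and nonjump: "\<And>i. i \<ge> 1 \<Longrightarrow> x - real i * \<rho> \<notin> \<int>"
  obtains y where "y < x" "phi a b \<rho> x < phi a b \<rho> y + e"
proof -
  obtain N where N: "a ^ N < e" using real_arch_pow_inv[of e a] assms by auto
  have "\<forall>\<^sub>F y in at_left x. \<forall>j\<in>{..<N}. \<lfloor>x - real (j + 1) * \<rho>\<rfloor> = \<lfloor>y - real (j + 1) * \<rho>\<rfloor>"
  proof (intro eventually_ball_finite ballI)
    fix j
    let ?c = "real (j + 1) * \<rho>"
    have "x - ?c \<noteq> of_int \<lfloor>x - ?c\<rfloor>" using nonjump[of "j + 1"] by (metis Ints_of_int le_add2)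
    then have *: "of_int \<lfloor>x - ?c\<rfloor> + ?c < x" using of_int_floor_le[of "x - ?c"] by linarith
    have "\<forall>\<^sub>F y in at_left x. y \<in> {of_int \<lfloor>x - ?c\<rfloor> + ?c<..<x}"
      by (rule eventually_at_left_real[OF *])
    then show "\<forall>\<^sub>F y in at_left x. \<lfloor>x - ?c\<rfloor> = \<lfloor>y - ?c\<rfloor>"
      by eventually_elim (simp, linarith)
  qed simp
  moreover have "\<forall>\<^sub>F y in at_left x. y \<in> {x - 1<..<x}"
    by (rule eventually_at_left_real) simp
  ultimately have "\<forall>\<^sub>F y in at_left x. y < x \<and> phi a b \<rho> x < phi a b \<rho> y + e"
  proof eventually_elim
    case (elim y)
    then show ?case using phi_close[OF a, of y x N \<rho> b] N by auto
  qed
  then show thesis using that eventually_happens'[OF trivial_limit_at_left_real] by blast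
qed

lemma strict_mono_phi:
  assumes a: "0 < a" "a < 1" and irr: "\<rho> \<notin> \<rat>"
  shows "strict_mono (phi a b \<rho>)"
proof (rule strict_monoI)
  fix x y :: real assume "x < y"
  then obtain n k where n: "n > 0" "x < real n * \<rho> - of_int k" "real n * \<rho> - of_int k < y"
    using irrational_multiples_dense[OF irr] by metis
  \<comment> \<open>The term of index \<open>m\<close> contains \<open>(m + 1) * \<rho>\<close>; its
    floor jumps at the point \<open>n * \<rho> - k\<close> between \<open>x\<close> and
    \<open>y\<close>, while no other term decreases.\<close>
  define m where "m = n - 1"
  have m: "real (m + 1) = real n" using n by (simp add: m_def)
  let ?f = "\<lambda>z j. a ^ j * of_int \<lfloor>z - real (j + 1) * \<rho>\<rfloor>"
  have "(\<Sum>j. ?f x j) < (\<Sum>j. ?f y j)"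
  proof -
    have "0 < (\<Sum>j. ?f y j - ?f x j)"
    proof (rule suminf_pos2[where i = m])
      show "summable (\<lambda>j. ?f y j - ?f x j)" by (intro summable_diff summable_phi a)
      show "0 \<le> ?f y j - ?f x j" for j
        using a \<open>x < y\<close> by (auto intro!: mult_left_mono floor_mono)
      have "\<lfloor>x - real (m + 1) * \<rho>\<rfloor> < \<lfloor>y - real (m + 1) * \<rho>\<rfloor>"
        unfolding m using n(2,3) less_le_trans[of "\<lfloor>x - real n * \<rho>\<rfloor>" "- k" "\<lfloor>y - real n * \<rho>\<rfloor>"]
        by (simp add: floor_less_iff le_floor_iff)
      then show "0 < ?f y m - ?f x m" using a by simp
    qed
    then show ?thesis
      unfolding suminf_diff[OF summable_phi[OF a] summable_phi[OF a], symmetric] by simp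
  qed
  then show "phi a b \<rho> x < phi a b \<rho> y" unfolding phi_def using a by simp
qed

lemma irrational_multiple_notin_Ints:
  fixes \<rho> :: real
  assumes "\<rho> \<notin> \<rat>" "i \<ge> 1"
  shows "real i * \<rho> \<notin> \<int>"
proof
  assume "real i * \<rho> \<in> \<int>"
  then have "real i * \<rho> / real i \<in> \<rat>" using Ints_subset_Rats by (intro Rats_divide) auto
  then show False using assms by simp
qed

text \<open>Normalised at 0, \<open>phi\<close> fixes every integer, so by strict monotonicity it
  preserves the intervals between integers. This turns \<open>phi_add_rotation\<close> into a
  semiconjugacy with \<open>F_minus\<close>.\<close>

lemma floor_phi:
  assumes a: "0 < a" "a < 1" and irr: "\<rho> \<notin> \<rat>" and "phi a b \<rho> 0 = 0"
  shows "\<lfloor>phi a b \<rho> x\<rfloor> = \<lfloor>x\<rfloor>"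
proof -
  have k: "phi a b \<rho> (of_int k) = of_int k" for k
    using phi_add_int[OF a, of b \<rho> 0 k] assms by simp
  have "phi a b \<rho> (of_int \<lfloor>x\<rfloor>) \<le> phi a b \<rho> x"
    using strict_mono_less_eq[OF strict_mono_phi[OF a irr]] by simp
  moreover have "phi a b \<rho> x < phi a b \<rho> (of_int (\<lfloor>x\<rfloor> + 1))"
    using strict_mono_less[OF strict_mono_phi[OF a irr]] by simp
  ultimately show ?thesis unfolding k by linarith
qed

lemma F_minus_iterate_phi:
  assumes a: "0 < a" "a < 1" and irr: "\<rho> \<notin> \<rat>" and "phi a b \<rho> 0 = 0"
  shows "(F_minus a b ^^ n) (phi a b \<rho> x) = phi a b \<rho> (x + real n * \<rho>)"
proof (induction n)
  case (Suc n)
  have "x + real (Suc n) * \<rho> = (x + real n * \<rho>) + \<rho>" by (simp add: algebra_simps)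
  then show ?case
    using Suc by (simp only: phi_add_rotation[OF a]) (simp add: F_minus_def floor_phi[OF assms])
qed simp

section \<open>The rotation number and the normalisation of phi at 0\<close>

text \<open>A lift commutes with integer translations, so an advance of at least \<open>p\<close> in
  \<open>q\<close> steps repeats: \<open>m * q\<close> steps advance by at least
  \<open>m * p\<close>.\<close>

lemma rotation_number_ge:
  assumes a: "0 < a" "a < 1" and rot: "is_rotation_number a b \<rho>"
    and q: "q > 0" "of_int p \<le> (F_minus a b ^^ q) 0"
  shows "of_int p \<le> real q * \<rho>"
proof -
  interpret degree_one "F_minus a b" by (rule degree_one_F_minus[OF a])
  have le: "real m * of_int p \<le> (F_minus a b ^^ (m * q)) 0" for m
  proof (induction m)
    case (Suc m)
    have "real (Suc m) * of_int p \<le> (F_minus a b ^^ q) 0 + of_int (int m * p)"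
      using q by (simp add: algebra_simps)
    also have "\<dots> = (F_minus a b ^^ q) (of_int (int m * p))"
      using iter_add_int[of q 0 "int m * p"] by simp
    also have "\<dots> \<le> (F_minus a b ^^ q) ((F_minus a b ^^ (m * q)) 0)"
      using Suc by (intro iter_mono) simp
    finally show ?case by (simp add: funpow_add)
  qed simp
  \<comment> \<open>The multiplier starts at 1: at iterate 0 the quotient is 0 by the convention for
    division by zero, and the bound could fail.\<close>
  have "strict_mono (\<lambda>m. Suc m * q)" using q by (auto intro!: strict_monoI)
  from LIMSEQ_subseq_LIMSEQ[OF _ this] rot
  have "(\<lambda>m. (F_minus a b ^^ (Suc m * q)) 0 / real (Suc m * q)) \<longlonglongrightarrow> \<rho>"
    unfolding is_rotation_number_def o_def by fastforce
  moreover have "of_int p / real q \<le> (F_minus a b ^^ (Suc m * q)) 0 / real (Suc m * q)" for m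
    using divide_right_mono[OF le[of "Suc m"], of "real (Suc m * q)"] q by (simp del: funpow.simps mult_Suc of_nat_Suc)
  ultimately have "of_int p / real q \<le> \<rho>" using LIMSEQ_le_const by blast
  then show ?thesis using q by (simp add: field_simps)
qed

lemma rotation_number_le:
  assumes a: "0 < a" "a < 1" and rot: "is_rotation_number a b \<rho>"
    and q: "q > 0" "(F_minus a b ^^ q) 0 \<le> of_int p"
  shows "real q * \<rho> \<le> of_int p"
proof -
  interpret degree_one "F_minus a b" by (rule degree_one_F_minus[OF a])
  have le: "(F_minus a b ^^ (m * q)) 0 \<le> real m * of_int p" for m
  proof (induction m)
    case (Suc m)
    have "(F_minus a b ^^ q) ((F_minus a b ^^ (m * q)) 0) \<le> (F_minus a b ^^ q) (of_int (int m * p))"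
      using Suc by (intro iter_mono) simp
    also have "\<dots> = (F_minus a b ^^ q) 0 + of_int (int m * p)"
      using iter_add_int[of q 0 "int m * p"] by simp
    also have "\<dots> \<le> real (Suc m) * of_int p"
      using q by (simp add: algebra_simps)
    finally show ?case by (simp add: funpow_add)
  qed simp
  have "strict_mono (\<lambda>m. Suc m * q)" using q by (auto intro!: strict_monoI)
  from LIMSEQ_subseq_LIMSEQ[OF _ this] rot
  have "(\<lambda>m. (F_minus a b ^^ (Suc m * q)) 0 / real (Suc m * q)) \<longlonglongrightarrow> \<rho>"
    unfolding is_rotation_number_def o_def by fastforce
  moreover have "(F_minus a b ^^ (Suc m * q)) 0 / real (Suc m * q) \<le> of_int p / real q" for m
    using divide_right_mono[OF le[of "Suc m"], of "real (Suc m * q)"] q by (simp del: funpow.simps mult_Suc of_nat_Suc)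
  ultimately have "\<rho> \<le> of_int p / real q" using LIMSEQ_le_const2 by blast
  then show ?thesis using q by (simp add: field_simps)
qed

text \<open>Replacing \<open>b\<close> by \<open>b' = b - (1 - a) \<phi>(0)\<close> normalises \<open>\<phi>\<close> at \<open>0\<close> without changing \<open>\<rho>\<close>.
  An irrational rotation number is strictly monotone in the offset, which forces \<open>b' = b\<close>.\<close>

lemma phi_zero:
  assumes a: "0 < a" "a < 1" and irr: "\<rho> \<notin> \<rat>" and rot: "is_rotation_number a b \<rho>"
  shows "phi a b \<rho> 0 = 0"
proof -
  define c where "c = phi a b \<rho> 0"
  define b' where "b' = b - (1 - a) * c"
  have phi': "phi a b' \<rho> x = phi a b \<rho> x - c" for x
    unfolding phi_def b'_def using a by (simp add: diff_divide_distrib)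
  have zero': "phi a b' \<rho> 0 = 0" by (simp add: phi' c_def)
  \<comment> \<open>The orbit of 0 is known in closed form for the offset \<open>b'\<close>, so it
    serves as the reference orbit for the comparison with \<open>b\<close>.\<close>
  have iter': "(F_minus a b' ^^ n) 0 = phi a b' \<rho> (real n * \<rho>)" for n
    using F_minus_iterate_phi[OF a irr zero', of n 0] zero' by simp
  have F: "F_minus a b x = F_minus a b' x + (1 - a) * c" for x
    by (simp add: F_minus_def b'_def)
  interpret degree_one "F_minus a b'" by (rule degree_one_F_minus[OF a])
  have "\<not> c > 0"
  proof
    assume c: "c > 0"
    have ge: "(F_minus a b' ^^ n) 0 \<le> (F_minus a b ^^ n) 0" for n
    proof (induction n)
      case (Suc n)
      show ?case using monoD[OF mono Suc] F[of "(F_minus a b ^^ n) 0"] mult_pos_pos[of "1 - a" c] c a by (simp del: zero_less_mult_iff mult_pos_pos)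
    qed simp
    \<comment> \<open>No positive multiple of \<open>\<rho>\<close> is an integer, so 0 is not a
      jump. For \<open>q * \<rho>\<close> just below \<open>p\<close>, the \<open>b'\<close>-orbit
      then falls short of \<open>p\<close> by less than \<open>(1 - a) * c\<close>. The larger
      offset gains that much in the last step alone, so \<open>p\<close> is reached although
      \<open>q * \<rho> < p\<close>.\<close>
    obtain y where y: "y < 0" "phi a b' \<rho> 0 < phi a b' \<rho> y + (1 - a) * c"
      using phi_left_continuous[OF a, of "(1 - a) * c" 0 \<rho> b'] a c
        irrational_multiple_notin_Ints[OF irr] by auto
    obtain q p where q: "q > 0" "y < real q * \<rho> - of_int p" "real q * \<rho> - of_int p < 0"
      using irrational_multiples_dense[OF irr y(1)] by metis
    obtain r where r: "q = Suc r" using q by (cases q) auto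
    have "phi a b' \<rho> (y + of_int p) \<le> phi a b' \<rho> (real q * \<rho>)"
      using q by (intro monoD[OF mono_phi[OF a]]) simp
    then have "of_int p \<le> (F_minus a b' ^^ q) 0 + (1 - a) * c"
      using y zero' by (simp add: iter' phi_add_int[OF a])
    also have "\<dots> \<le> (F_minus a b ^^ q) 0"
      using monoD[OF mono ge[of r]] F[of "(F_minus a b ^^ r) 0"] by (simp add: r)
    finally have "of_int p \<le> real q * \<rho>" by (rule rotation_number_ge[OF a rot q(1)])
    then show False using q by simp
  qed
  moreover have "\<not> c < 0"
  proof
    assume c: "c < 0"
    then have d: "(1 - a) * c < 0" using a by (simp add: mult_pos_neg)
    have ge: "(F_minus a b ^^ n) 0 \<le> (F_minus a b' ^^ n) 0" for n
    proof (induction n)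
      case (Suc n)
      show ?case using monoD[OF mono Suc] F[of "(F_minus a b ^^ n) 0"] d by simp
    qed simp
    \<comment> \<open>Mirror argument with right continuity: \<open>q * \<rho>\<close> lies just
      above \<open>p\<close>, and the loss \<open>(1 - a) * c\<close> in the last step keeps the
      \<open>b\<close>-orbit from passing \<open>p\<close>.\<close>
    obtain y where y: "0 < y" "phi a b' \<rho> y < phi a b' \<rho> 0 + - ((1 - a) * c)"
      using phi_right_continuous[OF a, of "- ((1 - a) * c)" 0 b' \<rho>] d by auto
    obtain q p where q: "q > 0" "0 < real q * \<rho> - of_int p" "real q * \<rho> - of_int p < y"
      using irrational_multiples_dense[OF irr y(1)] by metis
    obtain r where r: "q = Suc r" using q by (cases q) auto
    have "(F_minus a b ^^ q) 0 \<le> (F_minus a b' ^^ q) 0 + (1 - a) * c"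
      using monoD[OF mono ge[of r]] F[of "(F_minus a b ^^ r) 0"] by (simp add: r)
    moreover have "phi a b' \<rho> (real q * \<rho>) \<le> phi a b' \<rho> (y + of_int p)"
      using q by (intro monoD[OF mono_phi[OF a]]) simp
    ultimately have "(F_minus a b ^^ q) 0 \<le> of_int p"
      using y zero' by (simp add: iter' phi_add_int[OF a])
    then have "real q * \<rho> \<le> of_int p" by (rule rotation_number_le[OF a rot q(1)])
    then show False using q by simp
  qed
  ultimately show ?thesis by (simp add: c_def)
qed

section \<open>Fractional parts and the two branches of the map\<close>

lemma frac_plus_alt: "frac_plus x = x - of_int (\<lceil>x\<rceil> - 1)"
  by (simp add: frac_plus_def frac_def ceiling_def)

lemma frac_plus_bounds: "0 < frac_plus x" "frac_plus x \<le> 1"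
  using frac_lt_1[of "- x"] frac_ge_0[of "- x"] by (simp_all add: frac_plus_def)

lemma frac_plus_not_Ints: "x \<notin> \<int> \<Longrightarrow> frac_plus x = frac x"
  by (simp add: frac_plus_def frac_neg)

lemma frac_plus_Ints: "x \<in> \<int> \<Longrightarrow> frac_plus x = 1"
  by (simp add: frac_plus_def frac_neg)

lemma frac_plus_unique:
  assumes "0 < y" "y \<le> 1" "x = y + of_int k"
  shows "frac_plus x = y"
proof -
  have "\<lceil>x\<rceil> = k + 1" using assms by (intro ceiling_unique) auto
  then show ?thesis using assms by (simp add: frac_plus_alt)
qed

lemma frac_add_frac: "frac (frac x + y) = frac (x + y)"
  by (simp add: frac_def algebra_simps floor_diff_of_int)

lemma frac_plus_add_frac_plus: "frac_plus (frac_plus x + y) = frac_plus (x + y)"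
proof -
  have "frac_plus x + y = frac_plus (x + y) + of_int (\<lceil>x + y\<rceil> - \<lceil>x\<rceil>)"
    by (simp add: frac_plus_alt)
  then show ?thesis using frac_plus_unique frac_plus_bounds by blast
qed

lemma frac_eq_imp_eq:
  fixes u v :: real
  assumes "frac u = frac v" "\<bar>u - v\<bar> < 1"
  shows "u = v"
proof -
  have "u - v = of_int \<lfloor>u\<rfloor> - of_int \<lfloor>v\<rfloor>" using assms by (simp add: frac_def)
  then have "\<lfloor>u\<rfloor> = \<lfloor>v\<rfloor>" using assms by linarith
  then show ?thesis using assms by (simp add: frac_def)
qed

lemma f_minus_bounds: "0 \<le> f_minus a b x" "f_minus a b x < 1"
  by (simp_all add: f_minus_def frac_lt_1)

lemma f_plus_bounds: "0 < f_plus a b x" "f_plus a b x \<le> 1"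
  by (simp_all add: f_plus_def frac_plus_bounds)

lemma f_minus_plus_cases:
  "f_plus a b x = f_minus a b x \<or> f_minus a b x = 0 \<and> f_plus a b x = 1"
  by (cases "a * x + b \<in> \<int>")
    (simp_all add: f_plus_def f_minus_def frac_plus_Ints frac_plus_not_Ints)

lemma f_image_unit: "f_minus a b ` A \<subseteq> {0..1}" "f_plus a b ` A \<subseteq> {0..1}"
  using f_minus_bounds[of a b] f_plus_bounds[of a b] by (auto simp: less_imp_le)

text \<open>The image of [0,1] under the affine map has length \<open>a\<close>, less than 1, so
  reduction modulo 1 identifies no two of its points. Injectivity of both branches follows.\<close>

lemma affine_close:
  fixes a :: real
  assumes "0 < a" "a < 1" "x \<in> {0..1}" "y \<in> {0..1}"
  shows "\<bar>(a * x + b) - (a * y + b)\<bar> < 1"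
proof -
  have "\<bar>(a * x + b) - (a * y + b)\<bar> = a * \<bar>x - y\<bar>"
    using assms by (simp add: abs_mult flip: right_diff_distrib)
  also have "\<dots> \<le> a * 1" using assms by (intro mult_left_mono) auto
  finally show ?thesis using assms by simp
qed

lemma inj_on_f_minus:
  assumes a: "0 < a" "a < 1"
  shows "inj_on (f_minus a b) {0..1}"
proof (rule inj_onI)
  fix x y assume xy: "x \<in> {0..1}" "y \<in> {0..1}" and "f_minus a b x = f_minus a b y"
  then have "a * x + b = a * y + b"
    using frac_eq_imp_eq[OF _ affine_close[OF a xy, of b]] by (simp add: f_minus_def)
  then show "x = y" using a by simp
qed

lemma inj_on_f_plus:
  assumes a: "0 < a" "a < 1"
  shows "inj_on (f_plus a b) {0..1}"
proof (rule inj_onI)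
  fix x y assume xy: "x \<in> {0..1}" "y \<in> {0..1}" and "f_plus a b x = f_plus a b y"
  then have "frac (- (a * x + b)) = frac (- (a * y + b))"
    by (simp add: f_plus_def frac_plus_def)
  then have "- (a * x + b) = - (a * y + b)"
    by (rule frac_eq_imp_eq) (use affine_close[OF a xy, of b] in linarith)
  then show "x = y" using a by simp
qed

text \<open>Injectivity cancels \<open>i\<close> applications of \<open>g\<close> from an equation
  between the two sides, leaving \<open>e\<close> as a value of \<open>g\<close>. It serves for
  \<open>e = 1\<close> under \<open>f_minus\<close> and \<open>e = 0\<close> under
  \<open>f_plus\<close>.\<close>

lemma funpow_notin_next_image:
  assumes inj: "inj_on g A" and "g ` A \<subseteq> A" "e \<in> A" "e \<notin> g ` A"
  shows "(g ^^ i) e \<notin> (g ^^ Suc i) ` A"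
proof -
  have mem: "(g ^^ i) x \<in> A" if "x \<in> A" for i x
    using that assms(2) by (induction i) auto
  have "(g ^^ i) e \<noteq> (g ^^ Suc i) x" if "x \<in> A" for x
  proof (induction i)
    case 0
    then show ?case using assms(4) that by auto
  next
    case (Suc i)
    then show ?case
      using inj_onD[OF inj _ mem[OF assms(3), of i] mem[OF that, of "Suc i"]] by auto
  qed
  then show ?thesis by blast
qed

lemma subset_funpow_image:
  assumes "S \<subseteq> g ` S" "S \<subseteq> A"
  shows "S \<subseteq> (g ^^ n) ` A"
proof (induction n)
  case (Suc n)
  have "S \<subseteq> g ` S" by fact
  also have "\<dots> \<subseteq> g ` (g ^^ n) ` A" using Suc by blast
  finally show ?case by (simp add: image_comp)
qed (use assms in simp)

lemma f_pm_image_mono: "A \<subseteq> B \<Longrightarrow> f_pm_image a b A \<subseteq> f_pm_image a b B"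
  by (auto simp: f_pm_image_def)

lemma funpow_image_subset_f_pm_image:
  assumes "\<And>A. g ` A \<subseteq> f_pm_image a b A"
  shows "(g ^^ n) ` A \<subseteq> (f_pm_image a b ^^ n) A"
proof (induction n)
  case (Suc n)
  have "(g ^^ Suc n) ` A = g ` (g ^^ n) ` A" by (simp add: image_comp)
  also have "\<dots> \<subseteq> f_pm_image a b ((g ^^ n) ` A)" by (rule assms)
  also have "\<dots> \<subseteq> f_pm_image a b ((f_pm_image a b ^^ n) A)"
    by (rule f_pm_image_mono[OF Suc])
  finally show ?case by simp
qed simp

lemma omega_limit_mono:
  assumes "\<And>y. G y \<subseteq> H y"
  shows "omega_limit G x \<subseteq> omega_limit H x"
proof -
  have "is_orbit H x xs" if "is_orbit G x xs" for xs
    using that assms by (auto simp: is_orbit_def)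
  then show ?thesis unfolding omega_limit_def by blast
qed

lemma f_minus_frac: "f_minus a b (frac z) = frac (F_minus a b z)"
proof -
  have "F_minus a b z = (a * frac z + b) + of_int \<lfloor>z\<rfloor>"
    by (simp add: F_minus_def frac_def algebra_simps)
  then show ?thesis
    by (simp add: f_minus_def frac_def)
qed

lemma f_minus_iterate_frac: "(f_minus a b ^^ n) (frac z) = frac ((F_minus a b ^^ n) z)"
  by (induction n) (simp_all add: f_minus_frac)

lemma f_pm_affine:
  assumes "y \<in> f_pm a b x"
  obtains m where "y = a * x + b - of_int m"
proof -
  have "y = a * x + b - of_int \<lfloor>a * x + b\<rfloor> \<or> y = a * x + b - of_int (\<lceil>a * x + b\<rceil> - 1)"
    using assms unfolding f_pm_def f_minus_def f_plus_def frac_def frac_plus_alt by simp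
  then show thesis using that by blast
qed

text \<open>Together with \<open>f_pm_affine\<close> this describes \<open>f_pm\<close> as all
  integer translates of \<open>a * x + b\<close> that lie in [0,1]. An integer \<open>m\<close> used
  at one point can thus be reused at another once the value stays in the interval.\<close>

lemma affine_in_f_pm:
  assumes "a * x + b - of_int m \<in> {0..1}"
  shows "a * x + b - of_int m \<in> f_pm a b x"
proof (cases "a * x + b - of_int m < 1")
  case True
  then have "frac (a * x + b) = a * x + b - of_int m"
    using assms by (simp add: frac_unique_iff)
  then show ?thesis by (simp add: f_pm_def f_minus_def)
next
  case False
  then have "frac_plus (a * x + b) = a * x + b - of_int m"
    using assms by (intro frac_plus_unique[of _ _ m]) auto
  then show ?thesis by (simp add: f_pm_def f_plus_def)
qed

lemma f_pm_unit: "f_pm a b x \<subseteq> {0..1}"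
  using f_image_unit[of a b "{x}"] by (simp add: f_pm_def)

lemma is_orbit_singleton: "is_orbit (\<lambda>y. {g y}) x (\<lambda>n. (g ^^ n) x)"
  by (simp add: is_orbit_def)

lemma in_omega_limit_singletonI:
  assumes "p \<in> {0..1}" and close: "\<And>e N. e > 0 \<Longrightarrow> \<exists>n\<ge>N. \<bar>(g ^^ n) x - p\<bar> < e"
  shows "p \<in> omega_limit (\<lambda>y. {g y}) x"
proof -
  have "\<exists>r. \<forall>n. \<bar>(g ^^ r n) x - p\<bar> < inverse (real (Suc n)) \<and> r n < r (Suc n)"
  proof (rule dependent_nat_choice)
    show "\<exists>k. \<bar>(g ^^ k) x - p\<bar> < inverse (real (Suc 0))"
      using close[of 1 0] by auto
    fix k n
    show "\<exists>l. \<bar>(g ^^ l) x - p\<bar> < inverse (real (Suc (Suc n))) \<and> k < l"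
      using close[of "inverse (real (Suc (Suc n)))" "Suc k"] by (auto simp: Suc_le_eq)
  qed
  then obtain r where r: "\<And>n. \<bar>(g ^^ r n) x - p\<bar> < inverse (real (Suc n))" "\<And>n. r n < r (Suc n)"
    by blast
  have "(\<lambda>n. (g ^^ r n) x - p) \<longlonglongrightarrow> 0"
    by (rule Lim_null_comparison[OF always_eventually LIMSEQ_inverse_real_of_nat])
      (use r(1) in \<open>simp add: less_imp_le\<close>)
  then have "((\<lambda>n. (g ^^ n) x) \<circ> r) \<longlonglongrightarrow> p"
    by (simp add: o_def LIM_zero_iff)
  moreover have "strict_mono r" using r(2) by (simp add: strict_mono_Suc_iff)
  ultimately show ?thesis
    using assms(1) is_orbit_singleton[of g x] unfolding omega_limit_def by blast
qed

section \<open>phi and its left limits as semiconjugacies to the rotation\<close>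

text \<open>The rotation number is represented by \<open>zero\<close> and the bounds on
  \<open>\<rho>\<close>; strict bounds on \<open>b\<close> are recovered from them in
  \<open>b_bounds\<close>.\<close>

locale irrational_rotation =
  fixes a b \<rho> :: real
  assumes a: "0 < a" "a < 1" and irrational: "\<rho> \<notin> \<rat>" and \<rho>: "0 < \<rho>" "\<rho> < 1"
    and zero: "phi a b \<rho> 0 = 0"
begin

abbreviation "\<phi> \<equiv> phi a b \<rho>"
abbreviation "\<psi> \<equiv> phi_left a b \<rho>"

lemma phi_less [simp]: "\<phi> x < \<phi> y \<longleftrightarrow> x < y"
  by (rule strict_mono_less[OF strict_mono_phi[OF a irrational]])

lemma phi_le [simp]: "\<phi> x \<le> \<phi> y \<longleftrightarrow> x \<le> y"
  by (rule strict_mono_less_eq[OF strict_mono_phi[OF a irrational]])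

lemma phi_int: "\<phi> (of_int k) = of_int k"
  using phi_add_int[OF a, of b \<rho> 0 k] zero by simp

lemma phi_one: "\<phi> 1 = 1"
  using phi_int[of 1] by simp

lemma phi_le_psi:
  assumes "y < x"
  shows "\<phi> y \<le> \<psi> x"
proof (rule tendsto_lowerbound[OF tendsto_phi_left[OF a]])
  show "\<forall>\<^sub>F s in at_left x. \<phi> y \<le> \<phi> s"
    using eventually_at_left_real[OF assms] by eventually_elim simp
qed simp

lemma phi_less_psi:
  assumes "y < x"
  shows "\<phi> y < \<psi> x"
proof -
  obtain z where z: "y < z" "z < x" using dense[OF assms] by blast
  then have "\<phi> y < \<phi> z" by simp
  also have "\<dots> \<le> \<psi> x" by (rule phi_le_psi[OF z(2)])
  finally show ?thesis .
qed

lemma psi_leI: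
  assumes "\<And>s. s < x \<Longrightarrow> \<phi> s \<le> c"
  shows "\<psi> x \<le> c"
proof (rule tendsto_upperbound[OF tendsto_phi_left[OF a]])
  have "\<forall>\<^sub>F s in at_left x. s \<in> {x - 1<..<x}"
    by (rule eventually_at_left_real) simp
  then show "\<forall>\<^sub>F s in at_left x. \<phi> s \<le> c"
    by eventually_elim (use assms in auto)
qed simp

lemma psi_le_phi: "\<psi> x \<le> \<phi> x"
  by (rule psi_leI) simp

lemma psi_shift: "((\<lambda>s. \<phi> (s + c)) \<longlongrightarrow> \<psi> (x + c)) (at_left x)"
proof (rule filterlim_compose[OF tendsto_phi_left[OF a]])
  have "\<forall>\<^sub>F s in at_left x. s \<in> {x - 1<..<x}"
    by (rule eventually_at_left_real) simp
  then have "\<forall>\<^sub>F s in at_left x. s + c \<in> {..<x + c} \<and> s + c \<noteq> x + c"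
    by eventually_elim auto
  moreover have "((\<lambda>s. s + c) \<longlongrightarrow> x + c) (at_left x)"
    by (intro tendsto_intros)
  ultimately show "filterlim (\<lambda>s. s + c) (at_left (x + c)) (at_left x)"
    by (simp add: filterlim_at)
qed

lemma psi_add_int: "\<psi> (x + of_int k) = \<psi> x + of_int k"
proof -
  have "((\<lambda>s. \<phi> s + of_int k) \<longlongrightarrow> \<psi> x + of_int k) (at_left x)"
    by (intro tendsto_intros tendsto_phi_left a)
  then show ?thesis
    using tendsto_unique[OF _ psi_shift[of "of_int k" x]] by (simp add: phi_add_int[OF a])
qed

text \<open>Left limit of \<open>phi_add_rotation\<close>: just below \<open>x\<close> the floor
  equals \<open>\<lceil>x\<rceil> - 1\<close>, also when \<open>x\<close> is an integer.\<close>

lemma psi_add_rotation: "\<psi> (x + \<rho>) = a * \<psi> x + b + (1 - a) * of_int (\<lceil>x\<rceil> - 1)"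
proof -
  have "of_int (\<lceil>x\<rceil> - 1) < x" by linarith
  from eventually_at_left_real[OF this]
  have "\<forall>\<^sub>F s in at_left x. a * \<phi> s + b + (1 - a) * of_int (\<lceil>x\<rceil> - 1) = \<phi> (s + \<rho>)"
  proof eventually_elim
    case (elim s)
    then have "\<lfloor>s\<rfloor> = \<lceil>x\<rceil> - 1" by (simp; linarith)
    then show ?case by (simp add: phi_add_rotation[OF a])
  qed
  moreover have "((\<lambda>s. a * \<phi> s + b + (1 - a) * of_int (\<lceil>x\<rceil> - 1))
      \<longlongrightarrow> a * \<psi> x + b + (1 - a) * of_int (\<lceil>x\<rceil> - 1)) (at_left x)"
    by (intro tendsto_intros tendsto_phi_left a)
  ultimately have "((\<lambda>s. \<phi> (s + \<rho>)) \<longlongrightarrow> a * \<psi> x + b + (1 - a) * of_int (\<lceil>x\<rceil> - 1)) (at_left x)"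
    by (rule Lim_transform_eventually[rotated])
  then show ?thesis using tendsto_unique[OF _ psi_shift] by force
qed

lemma psi_eq_phi:
  assumes "\<And>i. i \<ge> 1 \<Longrightarrow> x - real i * \<rho> \<notin> \<int>"
  shows "\<psi> x = \<phi> x"
proof (rule antisym[OF psi_le_phi field_le_epsilon])
  fix e :: real assume "e > 0"
  then obtain y where "y < x" "\<phi> x < \<phi> y + e"
    using phi_left_continuous[OF a _ assms] by blast
  then show "\<phi> x \<le> \<psi> x + e" using phi_le_psi[of y x] by linarith
qed

lemma psi_int: "\<psi> (of_int k) = of_int k"
proof -
  have "of_int k - real i * \<rho> \<notin> \<int>" if "i \<ge> 1" for i
    using irrational_multiple_notin_Ints[OF irrational that] Ints_diff[OF Ints_of_int[of k]] by force
  then show ?thesis using psi_eq_phi phi_int by simp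
qed

lemma psi_zero: "\<psi> 0 = 0" and psi_one: "\<psi> 1 = 1"
  using psi_int[of 0] psi_int[of 1] by simp_all

lemma frac_phi: "frac (\<phi> x) = \<phi> (frac x)"
  using phi_add_int[OF a, of b \<rho> x "- \<lfloor>x\<rfloor>"] floor_phi[OF a irrational zero, of x]
  by (simp add: frac_def)

lemma frac_plus_psi: "frac_plus (\<psi> x) = \<psi> (frac_plus x)"
proof -
  have "\<lceil>\<psi> x\<rceil> = \<lceil>x\<rceil>"
  proof (rule ceiling_unique)
    show "of_int \<lceil>x\<rceil> - 1 < \<psi> x"
      using phi_less_psi[of "of_int (\<lceil>x\<rceil> - 1)" x] phi_int[of "\<lceil>x\<rceil> - 1"] by simp linarith
    have "\<phi> x \<le> \<phi> (of_int \<lceil>x\<rceil>)" by simp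
    then show "\<psi> x \<le> of_int \<lceil>x\<rceil>" using psi_le_phi[of x] unfolding phi_int by linarith
  qed
  then show ?thesis
    using psi_add_int[of x "- (\<lceil>x\<rceil> - 1)"] by (simp add: frac_plus_alt algebra_simps)
qed

lemma f_minus_phi: "f_minus a b (\<phi> (frac x)) = \<phi> (frac (x + \<rho>))"
proof -
  have "\<phi> (frac x + \<rho>) = a * \<phi> (frac x) + b" by (simp add: phi_add_rotation[OF a])
  then show ?thesis by (metis f_minus_def frac_phi frac_add_frac)
qed

lemma f_plus_psi: "f_plus a b (\<psi> (frac_plus x)) = \<psi> (frac_plus (x + \<rho>))"
proof -
  have "\<lceil>frac_plus x\<rceil> = 1" using frac_plus_bounds[of x] by (intro ceiling_unique) auto
  then have "\<psi> (frac_plus x + \<rho>) = a * \<psi> (frac_plus x) + b" by (simp add: psi_add_rotation)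
  then show ?thesis by (metis f_plus_def frac_plus_psi frac_plus_add_frac_plus)
qed

lemma multiple_not_Ints: "real (Suc i) * \<rho> \<notin> \<int>"
  by (rule irrational_multiple_notin_Ints[OF irrational]) simp

text \<open>The branches differ only where \<open>f_minus\<close> takes the value 0, and the
  \<open>f_minus\<close>-orbit of 0 never returns there because \<open>i * \<rho>\<close> is not an
  integer for positive \<open>i\<close>. So the semiconjugacy for \<open>f_minus\<close> computes an
  \<open>f_plus\<close>-orbit.\<close>

lemma f_plus_iterate_zero: "(f_plus a b ^^ i) 0 = \<phi> (frac (real i * \<rho>))"
proof (induction i)
  case (Suc i)
  have "real i * \<rho> + \<rho> = real (Suc i) * \<rho>" by (simp add: algebra_simps)
  then have f: "f_minus a b (\<phi> (frac (real i * \<rho>))) = \<phi> (frac (real (Suc i) * \<rho>))"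
    by (simp only: f_minus_phi)
  have "0 < frac (real (Suc i) * \<rho>)"
    using multiple_not_Ints[of i] by (simp only: frac_gt_0_iff not_False_eq_True)
  then have "\<phi> 0 < \<phi> (frac (real (Suc i) * \<rho>))" by (simp only: phi_less)
  then have "f_minus a b (\<phi> (frac (real i * \<rho>))) \<noteq> 0" using f zero by simp
  then show ?case using Suc f f_minus_plus_cases[of a b "\<phi> (frac (real i * \<rho>))"] by simp
qed (simp add: zero)

text \<open>Mirror image: the branches differ only where \<open>f_plus\<close> takes the value 1,
  which the orbit does not meet again. The start fits because
  \<open>frac_plus 0 = 1\<close>.\<close>

lemma f_minus_iterate_one: "(f_minus a b ^^ i) 1 = \<psi> (frac_plus (real i * \<rho>))"
proof (induction i)
  case (Suc i)
  have "real i * \<rho> + \<rho> = real (Suc i) * \<rho>" by (simp add: algebra_simps)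
  then have f: "f_plus a b (\<psi> (frac_plus (real i * \<rho>))) = \<psi> (frac_plus (real (Suc i) * \<rho>))"
    by (simp only: f_plus_psi)
  have "frac_plus (real (Suc i) * \<rho>) < 1"
    using frac_plus_not_Ints[OF multiple_not_Ints[of i]] frac_lt_1 by metis
  then have "\<phi> (frac_plus (real (Suc i) * \<rho>)) < 1"
    using phi_less[of _ 1] phi_one by simp
  then have "f_plus a b (\<psi> (frac_plus (real i * \<rho>))) \<noteq> 1"
    using f psi_le_phi[of "frac_plus (real (Suc i) * \<rho>)"] by linarith
  then show ?case using Suc f f_minus_plus_cases[of a b "\<psi> (frac_plus (real i * \<rho>))"] by simp
qed (simp add: psi_one frac_plus_Ints)

lemma phi_unit: "x \<in> {0..1} \<Longrightarrow> \<phi> x \<in> {0..1}"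
  using phi_le[of 0 x] phi_le[of x 1] zero phi_one by simp

lemma psi_unit:
  assumes "x \<in> {0..1}"
  shows "\<psi> x \<in> {0..1}"
proof -
  have "0 \<le> \<psi> x" using phi_le_psi[of 0 x] assms zero psi_zero by (cases "x = 0") auto
  then show ?thesis using phi_unit[OF assms] psi_le_phi[of x] by simp
qed

section \<open>The attractor: jumps, gaps and closure\<close>

definition attractor :: "real set" where
  "attractor = \<phi> ` {0..1} \<union> \<psi> ` {0..1}"

text \<open>Both functions fix 0 and 1, so each endpoint can be left to the other function. The two
  half-open pieces are the candidates for the invariant sets of \<open>f_minus\<close> and
  \<open>f_plus\<close>.\<close>

lemma attractor_decompose: "attractor = \<phi> ` {0..<1} \<union> \<psi> ` {0<..1}"
proof -
  have 1: "{0..1::real} = insert 1 {0..<1}" and 0: "{0..1::real} = insert 0 {0<..1}" by auto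
  have "\<phi> ` {0..1} = insert 1 (\<phi> ` {0..<1})" unfolding 1 image_insert phi_one ..
  moreover have "\<psi> ` {0..1} = insert 0 (\<psi> ` {0<..1})" unfolding 0 image_insert psi_zero ..
  ultimately have "attractor = insert 1 (\<phi> ` {0..<1}) \<union> insert 0 (\<psi> ` {0<..1})"
    unfolding attractor_def by (simp only:)
  moreover have "0 \<in> \<phi> ` {0..<1}" "1 \<in> \<psi> ` {0<..1}"
    using zero psi_one by (force, force)
  moreover have "insert 1 A \<union> insert 0 B = A \<union> B" if "0 \<in> A" "1 \<in> B" for A B :: "real set"
    using that by blast
  ultimately show ?thesis by presburger
qed

lemma phi_in_attractor: "x \<in> {0..1} \<Longrightarrow> \<phi> x \<in> attractor"
  and psi_in_attractor: "x \<in> {0..1} \<Longrightarrow> \<psi> x \<in> attractor"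
  unfolding attractor_def by (rule UnI1, rule imageI, assumption, rule UnI2, rule imageI)

lemma zero_in_attractor: "0 \<in> attractor" and one_in_attractor: "1 \<in> attractor"
  using phi_in_attractor[of 0] phi_in_attractor[of 1] zero phi_one by simp_all

lemma attractor_subset_unit: "attractor \<subseteq> {0..1}"
  unfolding attractor_def using phi_unit psi_unit by blast

lemma jump_unique:
  assumes "0 \<le> x" "x < 1" "\<psi> x \<noteq> \<phi> x"
  obtains i where "i \<ge> 1" "x = frac (real i * \<rho>)"
proof -
  obtain i where i: "i \<ge> 1" "x - real i * \<rho> \<in> \<int>" using psi_eq_phi assms(3) by blast
  have "real i * \<rho> - x \<in> \<int>" using Ints_minus[OF i(2)] by simp
  then have "frac (real i * \<rho>) = x" using assms by (simp add: frac_unique_iff)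
  then show thesis using that i(1) by simp
qed

text \<open>A left limit that is not a value of \<open>phi\<close> on [0,1) is 1 or sits at a jump.
  Jumps lie at \<open>frac (i * \<rho>)\<close> with positive \<open>i\<close>, where
  \<open>frac\<close> and \<open>frac_plus\<close> agree, so the left limit there is an iterate of
  1.\<close>

lemma attractor_minus_cases:
  assumes "y \<in> attractor"
  obtains "y \<in> \<phi> ` {0..<1}" | i where "y = (f_minus a b ^^ i) 1"
proof (cases "y \<in> \<phi> ` {0..<1}")
  case False
  then obtain x where x: "0 < x" "x \<le> 1" "y = \<psi> x"
    using assms unfolding attractor_decompose by auto
  show thesis
  proof (cases "x = 1")
    case True
    then show thesis using that(2)[of 0] x psi_one by simp
  next
    case x1: False
    then have "\<psi> x \<noteq> \<phi> x" using False x by auto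
    then obtain i where i: "i \<ge> 1" "x = frac (real i * \<rho>)" using jump_unique[of x] x x1 by auto
    then have "x = frac_plus (real i * \<rho>)"
      using frac_plus_not_Ints[OF irrational_multiple_notin_Ints[OF irrational]] by simp
    then show thesis using that(2)[of i] x(3) by (simp only: f_minus_iterate_one)
  qed
qed

lemma attractor_plus_cases:
  assumes "y \<in> attractor"
  obtains "y \<in> \<psi> ` {0<..1}" | i where "y = \<phi> (frac (real i * \<rho>))"
proof (cases "y \<in> \<psi> ` {0<..1}")
  case False
  then obtain x where x: "0 \<le> x" "x < 1" "y = \<phi> x"
    using assms unfolding attractor_decompose by auto
  show thesis
  proof (cases "x = 0")
    case True
    then show thesis using that(2)[of 0] x by simp
  next
    case x0: False
    have "\<psi> x \<noteq> \<phi> x"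
    proof
      assume "\<psi> x = \<phi> x"
      then have "y = \<psi> x" "x \<in> {0<..1}" using x x0 by simp_all
      then show False using False by blast
    qed
    then show thesis using jump_unique[of x] x that(2) by blast
  qed
qed

text \<open>The supremum of the \<open>x\<close> with \<open>phi x \<le> z\<close> is a generalised
  inverse of \<open>phi\<close> at \<open>z\<close>. It assigns a rotation parameter even to a point
  in a gap of the attractor.\<close>

lemma between_psi_phi:
  obtains t where "\<psi> t \<le> z" "z \<le> \<phi> t"
proof -
  let ?S = "{x. \<phi> x \<le> z}"
  have "\<phi> (of_int \<lfloor>z\<rfloor>) \<le> z" unfolding phi_int by simp
  then have ne: "?S \<noteq> {}" by blast
  have "x \<le> of_int \<lceil>z\<rceil>" if "x \<in> ?S" for x
  proof -
    have "z \<le> \<phi> (of_int \<lceil>z\<rceil>)" unfolding phi_int by simp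
    moreover have "\<phi> x \<le> z" using that by simp
    ultimately have "\<phi> x \<le> \<phi> (of_int \<lceil>z\<rceil>)" by linarith
    then show ?thesis by simp
  qed
  then have bdd: "bdd_above ?S" by (rule bdd_aboveI)
  show thesis
  proof (rule that[of "Sup ?S"])
    show "\<psi> (Sup ?S) \<le> z"
    proof (rule psi_leI)
      fix s assume "s < Sup ?S"
      then obtain x where "x \<in> ?S" "s < x" using less_cSup_iff[OF ne bdd] by blast
      then have "\<phi> s \<le> \<phi> x" "\<phi> x \<le> z" by simp_all
      then show "\<phi> s \<le> z" by linarith
    qed
    show "z \<le> \<phi> (Sup ?S)"
    proof (rule ccontr)
      assume "\<not> z \<le> \<phi> (Sup ?S)"
      then obtain y where y: "Sup ?S < y" "\<phi> y < \<phi> (Sup ?S) + (z - \<phi> (Sup ?S))"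
        using phi_right_continuous[OF a, of "z - \<phi> (Sup ?S)" "Sup ?S" b \<rho>] by (auto simp: not_le)
      then have "y \<le> Sup ?S" by (intro cSup_upper bdd) simp
      then show False using y by simp
    qed
  qed
qed

lemma closure_phi_image: "closure (\<phi> ` {0..<1}) = attractor"
proof
  show "closure (\<phi> ` {0..<1}) \<subseteq> attractor"
  proof
    fix y assume y: "y \<in> closure (\<phi> ` {0..<1})"
    have "\<phi> ` {0..<1} \<subseteq> {0..1}" using phi_unit by force
    then have "closure (\<phi> ` {0..<1}) \<subseteq> {0..1}" by (intro closure_minimal) auto
    then have y01: "y \<in> {0..1}" using y by blast
    obtain t where t: "\<psi> t \<le> y" "y \<le> \<phi> t" by (rule between_psi_phi)
    have "\<phi> 0 \<le> \<phi> t" using t y01 zero by simp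
    moreover have "t \<le> 1"
    proof (rule ccontr)
      assume "\<not> t \<le> 1"
      then have "\<phi> 1 < \<psi> t" by (intro phi_less_psi) simp
      then show False using t y01 phi_one by simp
    qed
    ultimately have t01: "t \<in> {0..1}" by simp
    \<comment> \<open>The open gap at \<open>t\<close> misses the range of \<open>phi\<close>:
      arguments below \<open>t\<close> give at most \<open>\<psi> t\<close>, the others at least
      \<open>\<phi> t\<close>. An open set missing a set also misses its closure.\<close>
    have "y = \<psi> t \<or> y = \<phi> t"
    proof (rule ccontr)
      assume "\<not> (y = \<psi> t \<or> y = \<phi> t)"
      then have "y \<in> {\<psi> t<..<\<phi> t}" using t by auto
      then obtain x where "\<phi> x \<in> {\<psi> t<..<\<phi> t}"
        using y open_Int_closure_eq_empty[OF open_greaterThanLessThan, of "\<psi> t" "\<phi> t" "\<phi> ` {0..<1}"]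
        by blast
      then show False using phi_le_psi[of x t] by auto
    qed
    then show "y \<in> attractor" using t01 phi_in_attractor psi_in_attractor by auto
  qed
  have psi: "\<psi> x \<in> closure (\<phi> ` {0..<1})" if "0 < x" "x \<le> 1" for x
  proof (rule Lim_in_closed_set[OF closed_closure _ _ tendsto_phi_left[OF a]])
    show "\<forall>\<^sub>F s in at_left x. \<phi> s \<in> closure (\<phi> ` {0..<1})"
      using eventually_at_left_real[OF that(1)]
    proof eventually_elim
      case (elim s)
      then show ?case using that by (intro subsetD[OF closure_subset]) auto
    qed
  qed simp
  have "\<phi> ` {0..<1} \<subseteq> closure (\<phi> ` {0..<1})" by (rule closure_subset)
  with psi show "attractor \<subseteq> closure (\<phi> ` {0..<1})"
    unfolding attractor_decompose by auto
qed

lemma closed_attractor: "closed attractor"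
  unfolding closure_phi_image[symmetric] by simp

lemma frac_of_unit: "x \<in> {0..<1} \<Longrightarrow> frac x = (x :: real)"
  by (simp add: frac_eq)

lemma frac_plus_of_unit: "x \<in> {0<..1} \<Longrightarrow> frac_plus x = x"
  using frac_plus_unique[of x x 0] by simp

section \<open>Invariance of the attractor and contraction towards it\<close>

lemma f_pm_attractor:
  assumes "x \<in> attractor"
  shows "f_pm a b x \<subseteq> attractor"
proof -
  \<comment> \<open>One branch is enough: if the two differ, their values are 0 and 1, which both
    belong to the attractor.\<close>
  have "f_minus a b x \<in> attractor \<or> f_plus a b x \<in> attractor"
  proof (cases rule: attractor_minus_cases[OF assms])
    case 1
    then obtain s where s: "s \<in> {0..<1}" "x = \<phi> s" by blast
    then have "f_minus a b x = \<phi> (frac (s + \<rho>))" using f_minus_phi[of s] frac_of_unit by simp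
    then show ?thesis using phi_in_attractor[of "frac (s + \<rho>)"] frac_lt_1[of "s + \<rho>"] by (simp add: less_imp_le)
  next
    case (2 i)
    have "f_minus a b x = \<psi> (frac_plus (real (Suc i) * \<rho>))"
      using f_minus_iterate_one[of "Suc i"] 2 by simp
    then show ?thesis
      using psi_in_attractor[of "frac_plus (real (Suc i) * \<rho>)"] frac_plus_bounds[of "real (Suc i) * \<rho>"]
      by (simp add: less_imp_le)
  qed
  then show ?thesis
    using f_minus_plus_cases[of a b x] zero_in_attractor one_in_attractor by (auto simp: f_pm_def)
qed

lemma phi_image_subset: "\<phi> ` {0..<1} \<subseteq> f_minus a b ` \<phi> ` {0..<1}"
proof
  fix y assume "y \<in> \<phi> ` {0..<1}"
  then obtain x where x: "x \<in> {0..<1}" "y = \<phi> x" by blast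
  then have "y = f_minus a b (\<phi> (frac (x - \<rho>)))"
    unfolding f_minus_phi by (simp add: frac_of_unit)
  then show "y \<in> f_minus a b ` \<phi> ` {0..<1}" using frac_lt_1[of "x - \<rho>"] by auto
qed

lemma psi_image_subset: "\<psi> ` {0<..1} \<subseteq> f_plus a b ` \<psi> ` {0<..1}"
proof
  fix y assume "y \<in> \<psi> ` {0<..1}"
  then obtain x where x: "x \<in> {0<..1}" "y = \<psi> x" by blast
  then have "y = f_plus a b (\<psi> (frac_plus (x - \<rho>)))"
    unfolding f_plus_psi by (simp add: frac_plus_of_unit)
  then show "y \<in> f_plus a b ` \<psi> ` {0<..1}" using frac_plus_bounds[of "x - \<rho>"] by auto
qed

lemma attractor_subset_image: "attractor \<subseteq> f_pm_image a b attractor"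
  unfolding attractor_decompose f_pm_image_def image_Un
  using phi_image_subset psi_image_subset by (auto simp del: image_subset_iff)

text \<open>The functional equation at 0 gives \<open>\<phi> \<rho> = b\<close>, and
  \<open>\<rho>\<close> lies strictly between the fixed points 0 and 1 of
  \<open>\<phi>\<close>.\<close>

lemma b_bounds: "0 < b" "b < 1"
proof -
  have "\<phi> \<rho> = b" using phi_add_rotation[OF a, of b \<rho> 0] zero by simp
  moreover have "\<phi> 0 < \<phi> \<rho>" "\<phi> \<rho> < \<phi> 1" using \<rho> by simp_all
  ultimately show "0 < b" "b < 1" using zero phi_one by simp_all
qed

lemma discontinuity_in_attractor:
  obtains c where "c \<in> attractor" "a * c + b = 1"
proof (rule that)
  \<comment> \<open>The rotation carries \<open>1 - \<rho>\<close> to 1, so the affine map carries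
    its image under \<open>\<phi>\<close> to \<open>\<phi> 1 = 1\<close>.\<close>
  show "\<phi> (1 - \<rho>) \<in> attractor" using \<rho> by (intro phi_in_attractor) simp
  have "\<lfloor>1 - \<rho>\<rfloor> = 0" using \<rho> by (simp add: floor_eq_iff)
  then show "a * \<phi> (1 - \<rho>) + b = 1"
    using phi_add_rotation[OF a, of b \<rho> "1 - \<rho>"] phi_one by simp
qed

text \<open>The point of discontinuity lies in the attractor, hence never strictly between \<open>x\<close> and a
  nearest point of the attractor; so one affine branch of slope \<open>a\<close> acts on both.\<close>

lemma infdist_attractor_step:
  assumes x: "x \<in> {0..1}" and y: "y \<in> f_pm a b x"
  shows "infdist y attractor \<le> a * infdist x attractor"
proof -
  have y01: "y \<in> {0..1}" using y f_pm_unit by blast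
  obtain m where m: "y = a * x + b - of_int m" using f_pm_affine[OF y] .
  obtain p where p: "p \<in> attractor" "infdist x attractor = dist x p"
    using infdist_attains_inf[OF closed_attractor, of x] zero_in_attractor by blast
  have p01: "p \<in> {0..1}" using p attractor_subset_unit by blast
  obtain c where c: "c \<in> attractor" "a * c + b = 1" by (rule discontinuity_in_attractor)
  have nearest: "dist x p \<le> dist x c" using infdist_le[OF c(1), of x] p(2) by simp
  have ap: "0 \<le> a * p" "a * p \<le> a" and ax: "0 \<le> a * x" "a * x \<le> a"
    using a p01 x by (auto simp: mult_le_cancel_left1)
  have y0: "0 \<le> y" and y1: "y \<le> 1" using y01 by simp_all
  have "real_of_int m < 2" "real_of_int m > -1" using m y0 y1 ax b_bounds a by linarith+
  then have m01: "m = 0 \<or> m = 1" by linarith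
  \<comment> \<open>The branch \<open>m\<close> is dictated by \<open>x\<close> and must be shown
    valid at \<open>p\<close>. If it sent \<open>p\<close> below 0, then
    \<open>p < c \<le> x\<close>, and \<open>c\<close> would be nearer to \<open>x\<close> than
    \<open>p\<close>.\<close>
  have lower: "0 \<le> a * p + b - of_int m"
  proof (rule ccontr)
    assume contra: "\<not> ?thesis"
    then have "m = 1" using m01 ap b_bounds by linarith
    then have "a * p < a * c" "a * c \<le> a * x" using contra c m y0 by linarith+
    then have "p < c" "c \<le> x" using a by auto
    then show False using nearest by (simp add: dist_real_def)
  qed
  have upper: "a * p + b - of_int m \<le> 1"
  proof (rule ccontr)
    assume contra: "\<not> ?thesis"
    then have "m = 0" using m01 ap b_bounds a by linarith
    then have "a * c < a * p" "a * x \<le> a * c" using contra c m y1 by linarith+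
    then have "c < p" "x \<le> c" using a by auto
    then show False using nearest by (simp add: dist_real_def)
  qed
  have "a * p + b - of_int m \<in> attractor"
    using affine_in_f_pm[of a p b m] lower upper f_pm_attractor[OF p(1)] by auto
  then have "infdist y attractor \<le> dist y (a * p + b - of_int m)" by (rule infdist_le)
  also have "\<dots> = \<bar>a * (x - p)\<bar>" unfolding m by (simp add: dist_real_def algebra_simps)
  also have "\<dots> = a * infdist x attractor" using a p(2) by (simp add: abs_mult dist_real_def)
  finally show ?thesis .
qed

lemma infdist_attractor_unit:
  assumes "x \<in> {0..1}"
  shows "infdist x attractor \<le> 1"
  using infdist_le[OF zero_in_attractor, of x] assms by (simp add: dist_real_def)

lemma infdist_orbit_attractor:
  assumes orb: "is_orbit (f_pm a b) x xs" and "x \<in> {0..1}"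
  shows "infdist (xs n) attractor \<le> a ^ n"
proof -
  have "xs n \<in> {0..1} \<and> infdist (xs n) attractor \<le> a ^ n"
  proof (induction n)
    case 0
    then show ?case using assms infdist_attractor_unit by (simp add: is_orbit_def)
  next
    case (Suc n)
    have step: "xs (Suc n) \<in> f_pm a b (xs n)" using orb by (simp add: is_orbit_def)
    then have "infdist (xs (Suc n)) attractor \<le> a * infdist (xs n) attractor"
      using Suc by (intro infdist_attractor_step) auto
    also have "\<dots> \<le> a * a ^ n" using Suc a by (intro mult_left_mono) auto
    finally show ?case using step f_pm_unit[of a b "xs n"] by auto
  qed
  then show ?thesis ..
qed

lemma infdist_le_powers_imp_attractor:
  assumes "\<And>n. infdist y attractor \<le> a ^ n"
  shows "y \<in> attractor"
proof -
  have "infdist y attractor \<le> 0"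
    by (rule LIMSEQ_le_const[OF LIMSEQ_realpow_zero]) (use a assms in auto)
  then have "infdist y attractor = 0" using infdist_nonneg[of y attractor] by simp
  then show ?thesis
    using in_closed_iff_infdist_zero[OF closed_attractor] zero_in_attractor by blast
qed

lemma f_pm_image_iterate_bound:
  assumes "y \<in> (f_pm_image a b ^^ n) {0..1}"
  shows "y \<in> {0..1} \<and> infdist y attractor \<le> a ^ n"
  using assms
proof (induction n arbitrary: y)
  case 0
  then show ?case using infdist_attractor_unit by simp
next
  case (Suc n)
  then obtain x where x: "x \<in> (f_pm_image a b ^^ n) {0..1}" "y \<in> f_pm a b x"
    unfolding funpow.simps o_apply f_pm_image_def[of a b "(f_pm_image a b ^^ n) {0..1}"] f_pm_def
    by blast
  have "infdist y attractor \<le> a * infdist x attractor"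
    using Suc.IH[OF x(1)] x(2) by (intro infdist_attractor_step) auto
  also have "\<dots> \<le> a * a ^ n" using Suc.IH[OF x(1)] a by (intro mult_left_mono) auto
  finally show ?case using x(2) f_pm_unit[of a b x] by auto
qed

section \<open>The three invariant sets\<close>

lemma Lambda_pm_eq: "Lambda_pm a b = attractor"
proof
  show "Lambda_pm a b \<subseteq> attractor"
  proof
    fix y assume "y \<in> Lambda_pm a b"
    then have "y \<in> (f_pm_image a b ^^ n) {0..1}" for n by (simp add: Lambda_pm_def)
    then show "y \<in> attractor"
      using f_pm_image_iterate_bound by (intro infdist_le_powers_imp_attractor) blast
  qed
  have "attractor \<subseteq> (f_pm_image a b ^^ n) {0..1}" for n
  proof (induction n)
    case (Suc n)
    show ?case
      using order_trans[OF attractor_subset_image f_pm_image_mono[OF Suc]] by simp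
  qed (simp add: attractor_subset_unit)
  then show "attractor \<subseteq> Lambda_pm a b" by (auto simp: Lambda_pm_def)
qed

lemma Lambda_minus_subset: "Lambda_minus a b \<subseteq> attractor"
proof -
  have "(f_minus a b ^^ n) ` {0..1} \<subseteq> (f_pm_image a b ^^ n) {0..1}" for n
    by (rule funpow_image_subset_f_pm_image) (simp add: f_pm_image_def)
  then show ?thesis
    unfolding Lambda_pm_eq[symmetric] Lambda_minus_def Lambda_pm_def by (intro INF_mono) blast
qed

lemma Lambda_plus_subset: "Lambda_plus a b \<subseteq> attractor"
proof -
  have "(f_plus a b ^^ n) ` {0..1} \<subseteq> (f_pm_image a b ^^ n) {0..1}" for n
    by (rule funpow_image_subset_f_pm_image) (simp add: f_pm_image_def)
  then show ?thesis
    unfolding Lambda_pm_eq[symmetric] Lambda_plus_def Lambda_pm_def by (intro INF_mono) blast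
qed

lemma Lambda_minus_eq: "Lambda_minus a b = \<phi> ` {0..<1}"
proof
  have "1 \<notin> f_minus a b ` {0..1}" using f_minus_bounds(2)[of a b] by (metis imageE less_irrefl)
  \<comment> \<open>The \<open>i\<close>-th iterate of 1 does lie in the \<open>i\<close>-th image;
    it is lost at level \<open>i + 1\<close>.\<close>
  then have "(f_minus a b ^^ i) 1 \<notin> (f_minus a b ^^ Suc i) ` {0..1}" for i
    by (intro funpow_notin_next_image inj_on_f_minus a f_image_unit) simp_all
  then have notin: "(f_minus a b ^^ i) 1 \<notin> Lambda_minus a b" for i
    unfolding Lambda_minus_def by blast
  show "Lambda_minus a b \<subseteq> \<phi> ` {0..<1}"
  proof
    fix y assume y: "y \<in> Lambda_minus a b"
    then have "y \<in> attractor" by (rule subsetD[OF Lambda_minus_subset])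
    then show "y \<in> \<phi> ` {0..<1}"
    proof (cases rule: attractor_minus_cases)
      case (2 i)
      then show ?thesis using y notin[of i] by simp
    qed
  qed
  have "\<phi> ` {0..<1} \<subseteq> {0..1}" using attractor_subset_unit attractor_decompose by blast
  then show "\<phi> ` {0..<1} \<subseteq> Lambda_minus a b"
    unfolding Lambda_minus_def by (intro INT_greatest subset_funpow_image phi_image_subset)
qed

lemma jump_values_notin_Lambda_plus: "\<phi> (frac (real i * \<rho>)) \<notin> Lambda_plus a b"
proof -
  have "0 \<notin> f_plus a b ` {0..1}" using f_plus_bounds(1)[of a b] by (metis imageE less_irrefl)
  then have "(f_plus a b ^^ i) 0 \<notin> (f_plus a b ^^ Suc i) ` {0..1}"
    by (intro funpow_notin_next_image inj_on_f_plus a f_image_unit) simp_all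
  then show ?thesis unfolding Lambda_plus_def f_plus_iterate_zero by blast
qed

lemma Lambda_plus_eq: "Lambda_plus a b = \<psi> ` {0<..1}"
proof
  show "Lambda_plus a b \<subseteq> \<psi> ` {0<..1}"
  proof
    fix y assume y: "y \<in> Lambda_plus a b"
    then have "y \<in> attractor" by (rule subsetD[OF Lambda_plus_subset])
    then show "y \<in> \<psi> ` {0<..1}"
    proof (cases rule: attractor_plus_cases)
      case (2 i)
      then show ?thesis using y jump_values_notin_Lambda_plus[of i] by simp
    qed
  qed
  have "\<psi> ` {0<..1} \<subseteq> {0..1}" using attractor_subset_unit attractor_decompose by blast
  then show "\<psi> ` {0<..1} \<subseteq> Lambda_plus a b"
    unfolding Lambda_plus_def by (intro INT_greatest subset_funpow_image psi_image_subset)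
qed

text \<open>That no left limit coincides with a value at a jump is taken from the dynamics: the left
  limits form \<open>Lambda_plus\<close>, which avoids the \<open>f_plus\<close>-orbit of 0. Index 0
  of that orbit accounts for the separate point 0.\<close>

lemma psi_image_eq:
  "\<psi> ` {0<..1} = attractor - ({0} \<union> {\<phi> (frac (real i * \<rho>)) | i. i \<ge> 1})"
proof -
  have "{0} \<union> {\<phi> (frac (real i * \<rho>)) | i. i \<ge> 1} = range (\<lambda>i. \<phi> (frac (real i * \<rho>)))"
  proof -
    have "\<phi> (frac (real i * \<rho>)) = 0 \<or> i \<ge> 1" for i using zero by (cases i) auto
    moreover have "0 = \<phi> (frac (real 0 * \<rho>))" using zero by simp
    ultimately show ?thesis by blast
  qed
  moreover have "\<psi> ` {0<..1} = attractor - range (\<lambda>i. \<phi> (frac (real i * \<rho>)))"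
  proof
    show "\<psi> ` {0<..1} \<subseteq> attractor - range (\<lambda>i. \<phi> (frac (real i * \<rho>)))"
      using Lambda_plus_subset jump_values_notin_Lambda_plus unfolding Lambda_plus_eq by blast
    show "attractor - range (\<lambda>i. \<phi> (frac (real i * \<rho>))) \<subseteq> \<psi> ` {0<..1}"
    proof
      fix y assume y: "y \<in> attractor - range (\<lambda>i. \<phi> (frac (real i * \<rho>)))"
      then have "y \<in> attractor" by blast
      then show "y \<in> \<psi> ` {0<..1}" by (cases rule: attractor_plus_cases) (use y in auto)
    qed
  qed
  ultimately show ?thesis by simp
qed

section \<open>Density of orbits in the attractor and the limit sets\<close>

lemma f_minus_orbit_dense_phi:
  assumes x: "x \<in> {0..<1}" and z: "z \<in> {0..<1}" and "e > 0"
  shows "\<exists>n\<ge>N. \<bar>(f_minus a b ^^ n) z - \<phi> x\<bar> < e"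
proof -
  interpret degree_one "F_minus a b" by (rule degree_one_F_minus[OF a])
  obtain y0 where y0: "x < y0" "\<phi> y0 < \<phi> x + e"
    by (rule phi_right_continuous[OF a \<open>e > 0\<close>])
  \<comment> \<open>The target is the one-sided interval from \<open>\<phi> x\<close> to
    \<open>\<phi> y\<close>. Keeping \<open>y < 1\<close> places it inside [0,1), so that reduction
    modulo 1 later removes exactly \<open>k\<close>.\<close>
  obtain y where y: "x < y" "y < min 1 y0"
    using dense[of x "min 1 y0"] x y0 by auto
  then have y1: "y < 1" and "\<phi> y < \<phi> y0" by simp_all
  then have ye: "\<phi> y < \<phi> x + e" using y0 by linarith
  obtain t where t: "\<psi> t \<le> z" "z \<le> \<phi> t" by (rule between_psi_phi)
  \<comment> \<open>The lower bound \<open>\<psi> t\<close> on \<open>z\<close> is only a left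
    limit, so \<open>z\<close> is enclosed by \<open>\<phi> (t - d)\<close> and
    \<open>\<phi> t\<close> instead. As \<open>d\<close> is smaller than \<open>y - x\<close>, one
    rotation can move both parameters between \<open>x\<close> and \<open>y\<close>.\<close>
  define d where "d = (y - x) / 2"
  have "x + d - t < y - t" using y by (simp add: d_def field_simps)
  then obtain n k where n: "n \<ge> N" "x + d - t < real n * \<rho> - of_int k" "real n * \<rho> - of_int k < y - t"
    using irrational_multiples_dense[OF irrational] by metis
  have iter: "(F_minus a b ^^ n) (\<phi> s) = \<phi> (s + real n * \<rho> - of_int k) + of_int k" for s
    using F_minus_iterate_phi[OF a irrational zero, of n s]
      phi_add_int[OF a, of b \<rho> "s + real n * \<rho> - of_int k" k] by simp
  have "\<phi> (t - d) \<le> z" using phi_le_psi[of "t - d" t] t y by (simp add: d_def)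
  then have "(F_minus a b ^^ n) (\<phi> (t - d)) \<le> (F_minus a b ^^ n) z" by (rule iter_mono)
  moreover have "\<phi> x \<le> \<phi> (t - d + real n * \<rho> - of_int k)" using n by simp
  moreover have "(F_minus a b ^^ n) z \<le> (F_minus a b ^^ n) (\<phi> t)" using t(2) by (rule iter_mono)
  moreover have "\<phi> (t + real n * \<rho> - of_int k) \<le> \<phi> y" using n by simp
  ultimately have bounds: "\<phi> x \<le> (F_minus a b ^^ n) z - of_int k" "(F_minus a b ^^ n) z - of_int k \<le> \<phi> y"
    unfolding iter by linarith+
  have "0 \<le> \<phi> x" using phi_unit[of x] x by simp
  moreover have "\<phi> y < 1" using y1 phi_less[of y 1] phi_one by simp
  ultimately have "frac ((F_minus a b ^^ n) z) = (F_minus a b ^^ n) z - of_int k"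
    using bounds by (simp add: frac_unique_iff)
  then have "(f_minus a b ^^ n) z = (F_minus a b ^^ n) z - of_int k"
    using f_minus_iterate_frac[where z = z] frac_of_unit[OF z] by simp
  then have "\<bar>(f_minus a b ^^ n) z - \<phi> x\<bar> < e" using bounds ye by simp
  then show ?thesis using n(1) by blast
qed

lemma f_minus_orbit_dense:
  assumes p: "p \<in> attractor" and z: "z \<in> {0..1}" and "e > 0"
  shows "\<exists>n\<ge>N. \<bar>(f_minus a b ^^ n) z - p\<bar> < e"
proof -
  have "p \<in> closure (\<phi> ` {0..<1})" using p closure_phi_image by simp
  then obtain x where x: "x \<in> {0..<1}" "dist (\<phi> x) p < e / 2"
    using \<open>e > 0\<close> unfolding closure_approachable by (metis half_gt_zero imageE)
  \<comment> \<open>One preliminary step handles \<open>z = 1\<close>, which is not its own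
    fractional part.\<close>
  have "f_minus a b z \<in> {0..<1}" using f_minus_bounds by simp
  from f_minus_orbit_dense_phi[OF x(1) this, of "e / 2" N]
  obtain n where n: "n \<ge> N" "\<bar>(f_minus a b ^^ n) (f_minus a b z) - \<phi> x\<bar> < e / 2"
    using \<open>e > 0\<close> by auto
  have "(f_minus a b ^^ Suc n) z = (f_minus a b ^^ n) (f_minus a b z)"
    by (simp only: funpow_Suc_right o_apply)
  then have "\<bar>(f_minus a b ^^ Suc n) z - p\<bar> < e" using n x(2) unfolding dist_real_def by linarith
  then show ?thesis using n(1) le_SucI by blast
qed

lemma f_plus_iterate_one: "(f_plus a b ^^ i) 1 = (f_minus a b ^^ i) 1"
  unfolding f_minus_iterate_one
proof (induction i)
  case (Suc i)
  have "real i * \<rho> + \<rho> = real (Suc i) * \<rho>" by (simp add: algebra_simps)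
  then show ?case using Suc f_plus_psi[of "real i * \<rho>"] by simp
qed (simp add: psi_one frac_plus_Ints)

text \<open>The orbits separate only when \<open>f_plus\<close> yields 1. If that never happens they
  coincide; if it does, the orbit continues from 1, where both branches generate the same
  orbit.\<close>

lemma f_plus_orbit_eventually_f_minus:
  assumes "z \<in> {0..1}"
  obtains m y where "y \<in> {0..1}" "\<And>n. (f_plus a b ^^ (n + m)) z = (f_minus a b ^^ n) y"
proof (cases "\<exists>m. (f_plus a b ^^ Suc m) z = 1")
  case True
  then obtain m where m: "(f_plus a b ^^ Suc m) z = 1" by blast
  have "(f_plus a b ^^ (n + Suc m)) z = (f_minus a b ^^ n) 1" for n
    by (simp only: funpow_add o_apply m f_plus_iterate_one)
  then show thesis using that[of 1 "Suc m"] by simp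
next
  case False
  have "(f_plus a b ^^ n) z = (f_minus a b ^^ n) z" for n
  proof (induction n)
    case (Suc n)
    have "f_plus a b ((f_plus a b ^^ n) z) \<noteq> 1" using False by auto
    then show ?case using Suc f_minus_plus_cases[of a b "(f_plus a b ^^ n) z"] by simp
  qed simp
  then show thesis using that[of z 0] assms by simp
qed

lemma f_plus_orbit_dense:
  assumes p: "p \<in> attractor" and z: "z \<in> {0..1}" and "e > 0"
  shows "\<exists>n\<ge>N. \<bar>(f_plus a b ^^ n) z - p\<bar> < e"
proof -
  obtain m y where y: "y \<in> {0..1}" "\<And>n. (f_plus a b ^^ (n + m)) z = (f_minus a b ^^ n) y"
    by (rule f_plus_orbit_eventually_f_minus[OF z]) blast
  obtain n where "n \<ge> N" "\<bar>(f_minus a b ^^ n) y - p\<bar> < e"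
    using f_minus_orbit_dense[OF p y(1) \<open>e > 0\<close>] by blast
  then show ?thesis using y(2)[of n] by (intro exI[of _ "n + m"]) simp
qed

lemma omega_limit_f_pm_subset:
  assumes "x \<in> {0..1}"
  shows "omega_limit (f_pm a b) x \<subseteq> attractor"
proof
  fix p assume "p \<in> omega_limit (f_pm a b) x"
  then obtain xs r where xs: "is_orbit (f_pm a b) x xs" "strict_mono r" "(xs \<circ> r) \<longlonglongrightarrow> p"
    unfolding omega_limit_def by blast
  have "(\<lambda>n. infdist ((xs \<circ> r) n) attractor) \<longlonglongrightarrow> infdist p attractor"
    by (intro tendsto_intros xs)
  moreover have "(\<lambda>n. infdist ((xs \<circ> r) n) attractor) \<longlonglongrightarrow> 0"
  proof (rule Lim_null_comparison)
    show "\<forall>\<^sub>F n in sequentially. norm (infdist ((xs \<circ> r) n) attractor) \<le> a ^ r n"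
      using infdist_orbit_attractor[OF xs(1) assms] infdist_nonneg[of _ attractor] by (simp add: always_eventually)
    show "(\<lambda>n. a ^ r n) \<longlonglongrightarrow> 0"
      using LIMSEQ_subseq_LIMSEQ[OF LIMSEQ_realpow_zero xs(2)] a by (simp add: o_def)
  qed
  ultimately have "infdist p attractor = 0" by (rule LIMSEQ_unique)
  then show "p \<in> attractor"
    using in_closed_iff_infdist_zero[OF closed_attractor] zero_in_attractor by blast
qed

text \<open>A sandwich: the attractor lies in the limit sets of the single branches, these lie in
  that of \<open>f_pm\<close> since every orbit of a branch is one of \<open>f_pm\<close>, and
  contraction confines the latter to the attractor.\<close>

lemma omega_limits_eq:
  assumes x: "x \<in> {0..1}"
  shows "omega_limit (f_pm a b) x = attractor"
    and "omega_limit (\<lambda>y. {f_minus a b y}) x = attractor"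
    and "omega_limit (\<lambda>y. {f_plus a b y}) x = attractor"
proof -
  have minus: "attractor \<subseteq> omega_limit (\<lambda>y. {f_minus a b y}) x"
    using f_minus_orbit_dense[OF _ x]
    by (intro subsetI in_omega_limit_singletonI subsetD[OF attractor_subset_unit])
  have plus: "attractor \<subseteq> omega_limit (\<lambda>y. {f_plus a b y}) x"
    using f_plus_orbit_dense[OF _ x]
    by (intro subsetI in_omega_limit_singletonI subsetD[OF attractor_subset_unit])
  have minus_pm: "omega_limit (\<lambda>y. {f_minus a b y}) x \<subseteq> omega_limit (f_pm a b) x"
    and plus_pm: "omega_limit (\<lambda>y. {f_plus a b y}) x \<subseteq> omega_limit (f_pm a b) x"
    by (rule omega_limit_mono; simp add: f_pm_def)+
  note pm = omega_limit_f_pm_subset[OF x]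
  show "omega_limit (f_pm a b) x = attractor"
    using pm order_trans[OF minus minus_pm] by (rule antisym)
  show "omega_limit (\<lambda>y. {f_minus a b y}) x = attractor"
    using order_trans[OF minus_pm pm] minus by (rule antisym)
  show "omega_limit (\<lambda>y. {f_plus a b y}) x = attractor"
    using order_trans[OF plus_pm pm] plus by (rule antisym)
qed

lemma uniform_limit_infdist_orbit:
  "uniform_limit {xs. \<exists>x\<in>{0..1}. is_orbit (f_pm a b) x xs}
    (\<lambda>n xs. infdist (xs n) attractor) (\<lambda>xs. 0) sequentially"
proof (rule uniform_limitI)
  fix e :: real assume "e > 0"
  have "(\<lambda>n. a ^ n) \<longlonglongrightarrow> 0" using a by (intro LIMSEQ_realpow_zero) auto
  then have "\<forall>\<^sub>F n in sequentially. a ^ n < e" using \<open>e > 0\<close> by (rule order_tendstoD)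
  then show "\<forall>\<^sub>F n in sequentially. \<forall>xs\<in>{xs. \<exists>x\<in>{0..1}. is_orbit (f_pm a b) x xs}.
      dist (infdist (xs n) attractor) 0 < e"
  proof eventually_elim
    case (elim n)
    have "infdist (xs n) attractor < e" if "is_orbit (f_pm a b) x xs" "x \<in> {0..1}" for x xs
      using infdist_orbit_attractor[OF that, of n] elim by linarith
    then show ?case using infdist_nonneg[of _ attractor] by auto
  qed
qed

end

theorem theorem9p2:
  fixes a b \<rho> :: real
  assumes "0 < a" "a < 1" "0 \<le> b" "b < 1"
    and "\<rho> = rotation_number a b" and "\<rho> \<notin> \<rat>"
  shows "Lambda_pm a b = closure (phi a b \<rho> ` {0..<1})
    \<and> closure (phi a b \<rho> ` {0..<1}) = phi a b \<rho> ` {0..1} \<union> phi_left a b \<rho> ` {0..1}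
    \<and> Lambda_minus a b = phi a b \<rho> ` {0..<1}
    \<and> Lambda_plus a b = phi_left a b \<rho> ` {0<..1}
    \<and> phi_left a b \<rho> ` {0<..1}
        = closure (phi a b \<rho> ` {0..<1}) - ({0} \<union> {phi a b \<rho> (frac (real i * \<rho>)) | i. i \<ge> 1})
    \<and> (\<forall>x\<in>{0..1}.
          omega_limit (f_pm a b) x = Lambda_pm a b
        \<and> omega_limit (\<lambda>y. {f_minus a b y}) x = Lambda_pm a b
        \<and> omega_limit (\<lambda>y. {f_plus a b y}) x = Lambda_pm a b)
    \<and> (\<forall>x\<in>{0..1}. \<forall>xs. is_orbit (f_pm a b) x xs \<longrightarrow>
          (\<forall>n. infdist (xs n) (Lambda_pm a b) \<le> a ^ n))
    \<and> uniform_limit {xs. \<exists>x\<in>{0..1}. is_orbit (f_pm a b) x xs}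
        (\<lambda>n xs. infdist (xs n) (Lambda_pm a b)) (\<lambda>xs. 0) sequentially"
proof -
  have rot: "is_rotation_number a b \<rho>"
    using is_rotation_number_rotation_number assms(1-5) by simp
  then have "0 \<le> \<rho>" "\<rho> < 1" by (simp_all add: is_rotation_number_def)
  moreover have "\<rho> \<noteq> 0" using assms(6) by auto
  moreover have "phi a b \<rho> 0 = 0" by (rule phi_zero[OF assms(1,2,6) rot])
  ultimately interpret irrational_rotation a b \<rho>
    using assms by unfold_locales auto
  show ?thesis
    unfolding Lambda_pm_eq closure_phi_image
    by (intro conjI ballI allI impI refl attractor_def Lambda_minus_eq Lambda_plus_eq psi_image_eq
        omega_limits_eq infdist_orbit_attractor uniform_limit_infdist_orbit)
qed

end
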